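(* Consider the distributed sequential test described in the context, and let $k=Nr^2$. There is a constant $c>0$, which may be chosen independent of $\epsilon$ and of the thresholds, such that the following holds for every $\epsilon\in(0,1/2)$. Take $\alpha=\beta=\epsilon$ and choose, for all $i=1,\dots,N$, the thresholds $$\gamma_{d,i}^{h}=\frac{8(k+1)}{7N}\left(\log\left(\frac{2}{\epsilon}\right)-\log\left(1-e^{-\frac{Nm}{4(k+1)}}\right)\right),\qquad \gamma_{d,i}^{l}=\frac{8(k+1)}{7N}\left(\log\left(\frac{\epsilon}{2}\right)+\log\left(1-e^{-\frac{Nm}{4(k+1)}}\right)\right).$$ Then the stopping time $T_{d,i}$ of each agent $i$ satisfies $$\frac{(1-2\epsilon)\gamma_{d,i}^{h}}{m}-\frac{c}{m}\ \le\ \mathbb{E}_1[T_{d,i}]\ \le\ \frac{5\gamma_{d,i}^{h}}{4m}+\frac{1}{1-e^{-\frac{Nm}{4(k+1)}}}.$$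
   Context: Observation model: there are $N$ agents; at each time $t=1,2,\dots$ agent $i$ observes $y_i(t)=\mu_\theta+n_i(t)$ under hypothesis $H_\theta$, $\theta\in\{0,1\}$, with $\mu_1=\mu$, $\mu_0=-\mu$, $\mu\neq 0$. The noises $n_i(t)$ are independent over all agents $i$ and times $t$, each Gaussian with mean $0$ and variance $\sigma^2>0$, under both hypotheses. $\mathbb{P}_\theta,\mathbb{E}_\theta$ denote probability and expectation under $H_\theta$. The log-likelihood ratio at agent $i$ is $\eta_i(t)=2\mu y_i(t)/\sigma^2$, and $\boldsymbol\eta(t)=(\eta_1(t),\dots,\eta_N(t))^\top$. Put $m=2\mu^2/\sigma^2$; thus $\eta_i(t)\sim\mathcal N(m,2m)$ under $H_1$ and $\mathcal N(-m,2m)$ under $H_0$ (mean, variance). Network: $G=(V,E)$ is a connected simple undirected graph on the agents $V=\{1,\dots,N\}$. $\mathbf W=[w_{ij}]$ is an $N\times N$ non-negative, symmetric, irreducible, stochastic (rows sum to one) matrix with $w_{ij}=0$ whenever $i\ne j$ and $(i,j)\notin E$. Let $\mathbf J=\frac1N\mathbf 1\mathbf 1^\top$ and $r=\|\mathbf W-\mathbf J\|$ (induced $\mathcal L_2$ norm), and assume $r<1$. Test: the vector of agent statistics $\mathbf S_d(t)=(S_{d,1}(t),\dots,S_{d,N}(t))^\top$ is given by $\mathbf S_d(0)=\mathbf 0$ and $\mathbf S_d(t+1)=\mathbf W(\mathbf S_d(t)+\boldsymbol\eta(t+1))$, i.e. $S_{d,i}(t)=\sum_{j=1}^t\mathbf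 e_i^\top\mathbf W^{t+1-j}\boldsymbol\eta(j)$. Given thresholds $\gamma_{d,i}^l,\gamma_{d,i}^h\in\mathbb R$, the stopping time of agent $i$ is $T_{d,i}=\inf\{t\ge1: S_{d,i}(t)\notin[\gamma_{d,i}^l,\gamma_{d,i}^h]\}$. Here $\alpha$ and $\beta$ are the prescribed upper bounds on the probabilities of false alarm $\mathbb P_0(S_{d,i}(T_{d,i})\ge\gamma_{d,i}^h)$ and of miss $\mathbb P_1(S_{d,i}(T_{d,i})\le\gamma_{d,i}^l)$. The constant $c$ may depend on the network ($G$, $\mathbf W$) and on the model parameters $\mu,\sigma^2$. $\log$ is the natural logarithm. *)

theory Defs
  imports "HOL-Probability.Probability"
begin

datatype hyp = H0 | H1

primrec signal_mean :: "real \<Rightarrow> hyp \<Rightarrow> real" where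
  "signal_mean \<mu> H0 = - \<mu>"
| "signal_mean \<mu> H1 = \<mu>"

text \<open>
  The observations \<^term>\<open>y i t\<close> live on one measurable space carrying the two laws
  \<^term>\<open>P H0\<close> and \<^term>\<open>P H1\<close>; the noise of agent \<^term>\<open>i\<close> at time \<^term>\<open>t\<close> under
  \<^term>\<open>\<theta>\<close> is \<^term>\<open>y i t\<close> minus the signal mean. Time starts at 1, so \<^term>\<open>y i 0\<close> is
  unconstrained and never used. The parameter \<^term>\<open>\<sigma>\<close> is the standard deviation.
\<close>

definition gaussian_shift_model ::
    "real \<Rightarrow> real \<Rightarrow> (hyp \<Rightarrow> 'a measure) \<Rightarrow> ('n::finite \<Rightarrow> nat \<Rightarrow> 'a \<Rightarrow> real) \<Rightarrow> bool" where
  "gaussian_shift_model \<mu> \<sigma> P y \<longleftrightarrow>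
     sets (P H0) = sets (P H1) \<and>
     (\<forall>\<theta>. prob_space (P \<theta>) \<and>
          prob_space.indep_vars (P \<theta>) (\<lambda>_. borel)
            (\<lambda>(i, t) \<omega>. y i t \<omega> - signal_mean \<mu> \<theta>) (UNIV \<times> {1..}) \<and>
          (\<forall>i. \<forall>t\<ge>1. distributed (P \<theta>) lborel
             (\<lambda>\<omega>. y i t \<omega> - signal_mean \<mu> \<theta>) (normal_density 0 \<sigma>)))"

definition connected_simple_graph :: "('n \<times> 'n) set \<Rightarrow> bool" where
  "connected_simple_graph E \<longleftrightarrow> sym E \<and> irrefl E \<and> (\<forall>i j. (i, j) \<in> E\<^sup>*)"

text \<open>
  No simultaneous permutation of rows and columns brings the matrix into block triangular
  form with two nonempty square diagonal blocks; \<^term>\<open>I\<close> is the index set of one block.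
\<close>

definition irreducible_matrix :: "real^'n^'n \<Rightarrow> bool" where
  "irreducible_matrix A \<longleftrightarrow>
     \<not> (\<exists>I. I \<noteq> {} \<and> I \<noteq> UNIV \<and> (\<forall>i\<in>I. \<forall>j\<in>-I. A $ i $ j = 0))"

definition weight_matrix :: "('n::finite \<times> 'n) set \<Rightarrow> real^'n^'n \<Rightarrow> bool" where
  "weight_matrix E W \<longleftrightarrow>
     (\<forall>i j. 0 \<le> W $ i $ j) \<and>
     transpose W = W \<and>
     irreducible_matrix W \<and>
     (\<forall>i. (\<Sum>j\<in>UNIV. W $ i $ j) = 1) \<and>
     (\<forall>i j. i \<noteq> j \<and> (i, j) \<notin> E \<longrightarrow> W $ i $ j = 0)"

definition averaging_matrix :: "real^'n::finite^'n" where
  "averaging_matrix = (\<chi> i j. 1 / real CARD('n))"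

definition llr :: "real \<Rightarrow> real \<Rightarrow> ('n::finite \<Rightarrow> nat \<Rightarrow> 'a \<Rightarrow> real) \<Rightarrow> nat \<Rightarrow> 'a \<Rightarrow> real^'n" where
  "llr \<mu> \<sigma> y t \<omega> = (\<chi> i. 2 * \<mu> * y i t \<omega> / \<sigma>\<^sup>2)"

primrec agent_stat :: "real^'n^'n \<Rightarrow> (nat \<Rightarrow> 'a \<Rightarrow> real^'n) \<Rightarrow> nat \<Rightarrow> 'a \<Rightarrow> real^'n::finite" where
  "agent_stat W \<eta> 0 \<omega> = 0"
| "agent_stat W \<eta> (Suc t) \<omega> = W *v (agent_stat W \<eta> t \<omega> + \<eta> (Suc t) \<omega>)"

text \<open>The value is \<^term>\<open>\<infinity> :: enat\<close> on paths that never leave the interval.\<close>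

definition exit_time ::
    "(nat \<Rightarrow> 'a \<Rightarrow> real^'n::finite) \<Rightarrow> 'n \<Rightarrow> real \<Rightarrow> real \<Rightarrow> 'a \<Rightarrow> enat" where
  "exit_time S i l h \<omega> = Inf (enat ` {t. 1 \<le> t \<and> S t \<omega> $ i \<notin> {l..h}})"

definition expected_time :: "'a measure \<Rightarrow> ('a \<Rightarrow> enat) \<Rightarrow> ereal" where
  "expected_time M T = enn2ereal (\<integral>\<^sup>+ \<omega>. ennreal_of_enat (T \<omega>) \<partial>M)"

end

theory Submission
  imports Defs
begin

text \<open>
  Under \<open>H1\<close> the statistic \<open>S\<^sub>i(t)\<close> is normal with mean \<open>m t\<close> and variance at most
  \<open>2 m t (k + 1) / N\<close>, because each row of a power of \<open>W\<close> splits orthogonally into its average and a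
  deviation of norm at most \<open>r\<close>.

  Upper bound: \<open>E T\<close> is the sum of \<open>P(T > t) \<le> P(S\<^sub>i(t) \<le> \<gamma>)\<close>. For \<open>t \<ge> \<gamma> / m\<close> the Gaussian tail
  bound, with its factor \<open>1/2\<close>, is dominated by a geometric series. The factor \<open>1/2\<close> is what makes
  the constant \<open>5/4\<close> attainable.

  Lower bound: the network average \<open>s\<close> is a random walk with drift \<open>m\<close>. Stop it at \<open>T' \<le> T\<close>, when
  \<open>S\<^sub>i\<close> leaves \<open>[-\<gamma>, \<gamma>]\<close> or \<open>s\<close> exceeds \<open>\<gamma>\<close>; then \<open>\<gamma> - m E T' = E (\<gamma> - s(T'))\<close>, and it remains
  to bound the right-hand side by a constant. If \<open>S\<^sub>i\<close> exits above while \<open>s \<le> \<gamma>\<close>, then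
  \<open>\<gamma> - s \<le> exp (2 (S\<^sub>i - s)) exp (s - \<gamma>)\<close>. By the Cameron--Martin formula the first factor can be
  averaged out separately, with a bounded result, and the sum over time of the second one is bounded
  because the walk leaves the half-line below \<open>\<gamma>\<close> quickly. If \<open>S\<^sub>i\<close> exits below, then
  \<open>\<gamma> - s \<le> - (S\<^sub>i + s)\<close>, whose positive part has exponentially small expectation in \<open>t\<close>.
\<close>

section \<open>Summation of Gaussian tail bounds\<close>

lemma exp_neg_mult_le_chord:
  fixes c \<theta> :: real
  assumes "0 \<le> \<theta>" "\<theta> \<le> 1"
  shows "exp (- (c * (1 - \<theta>))) \<le> \<theta> + (1 - \<theta>) * exp (- c)"
  using convex_onD[OF convex_on_exp[of 1], of "1 - \<theta>" 0 "- c"] assms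
  by (simp add: algebra_simps)

lemma suminf_min_one_exp_le:
  fixes c \<tau> :: real
  assumes c: "c > 0" and \<tau>: "\<tau> \<ge> 0"
  shows "summable (\<lambda>t. min 1 (exp (- (c * (real t - \<tau>)))))"
    and "(\<Sum>t. min 1 (exp (- (c * (real t - \<tau>))))) \<le> \<tau> + 1 / (1 - exp (- c))"
proof -
  define f where "f t = min 1 (exp (- (c * (real t - \<tau>))))" for t :: nat
  define n where "n = nat \<lfloor>\<tau>\<rfloor>"
  define \<theta> where "\<theta> = \<tau> - real n"
  have \<theta>: "0 \<le> \<theta>" "\<theta> \<le> 1"
    using \<tau> unfolding \<theta>_def n_def by linarith+
  have tail: "f (t + Suc n) = exp (- (c * (1 - \<theta>))) * exp (- c) ^ t" for t
  proof -
    have "0 \<le> c * (real (t + Suc n) - \<tau>)"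
      using c \<theta> by (simp add: \<theta>_def)
    then have "f (t + Suc n) = exp (- (c * (real (t + Suc n) - \<tau>)))"
      by (simp add: f_def)
    also have "- (c * (real (t + Suc n) - \<tau>)) = - (c * (1 - \<theta>)) + real t * (- c)"
      by (simp add: \<theta>_def algebra_simps)
    finally show ?thesis by (simp only: exp_add exp_of_nat_mult)
  qed
  have tail_sums: "(\<lambda>t. f (t + Suc n)) sums (exp (- (c * (1 - \<theta>))) * (1 / (1 - exp (- c))))"
    unfolding tail using c by (intro sums_mult geometric_sums) simp
  then have summable: "summable f"
    using summable_iff_shift[of f "Suc n"] by (simp add: sums_iff)
  then show "summable (\<lambda>t. min 1 (exp (- (c * (real t - \<tau>)))))"
    by (simp add: f_def[abs_def])
  have "suminf f = exp (- (c * (1 - \<theta>))) * (1 / (1 - exp (- c))) + (\<Sum>t<Suc n. f t)"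
    using suminf_split_initial_segment[OF summable, of "Suc n"] tail_sums by (simp add: sums_iff)
  also have "(\<Sum>t<Suc n. f t) \<le> real (card {..<Suc n}) * 1"
    by (rule sum_bounded_above) (simp add: f_def)
  also have "exp (- (c * (1 - \<theta>))) \<le> \<theta> + (1 - \<theta>) * exp (- c)"
    using \<theta> by (rule exp_neg_mult_le_chord)
  finally have "suminf f \<le> (\<theta> + (1 - \<theta>) * exp (- c)) * (1 / (1 - exp (- c))) + real (Suc n)"
    using c by (simp add: mult_right_mono divide_right_mono)
  also have "\<dots> = \<tau> + 1 / (1 - exp (- c))"
    using c by (simp add: \<theta>_def field_simps)
  finally show "(\<Sum>t. min 1 (exp (- (c * (real t - \<tau>))))) \<le> \<tau> + 1 / (1 - exp (- c))"
    by (simp add: f_def[abs_def])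
qed

text \<open>
  The exponent on the right is the tangent of the convex function \<open>q (t - x)\<^sup>2 / t\<close> at
  \<open>t = x / (1 - s)\<close>.
\<close>

lemma exp_gaussian_exponent_le_tangent:
  fixes q s t x :: real
  assumes "q > 0" "t > 0" "s < 2"
  shows "exp (- (q * (t - x)\<^sup>2 / t)) \<le> exp (- ((2 * s - s\<^sup>2) * q * (t - 2 * x / (2 - s))))"
proof -
  have "0 \<le> ((1 - s) * t - x)\<^sup>2" by simp
  then have "((2 * s - s\<^sup>2) * t - 2 * s * x) * t \<le> (t - x)\<^sup>2"
    by (simp add: power2_eq_square algebra_simps)
  then have "q * ((2 * s - s\<^sup>2) * t - 2 * s * x) \<le> q * ((t - x)\<^sup>2 / t)"
    using assms by (intro mult_left_mono) (simp_all add: pos_le_divide_eq)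
  moreover have "(2 * s - s\<^sup>2) * q * (t - 2 * x / (2 - s)) = q * ((2 * s - s\<^sup>2) * t - 2 * s * x)"
    using assms(3) by (simp add: field_simps power2_eq_square)
  ultimately show ?thesis by (simp only: exp_le_cancel_iff neg_le_iff_le times_divide_eq_right)
qed

lemma sums_of_bool_less:
  fixes x :: real
  assumes "x \<ge> 0"
  shows "(\<lambda>t. of_bool (real t < x)) sums real (nat \<lceil>x\<rceil>)"
proof -
  have "real t < x \<longleftrightarrow> t \<in> {..<nat \<lceil>x\<rceil>}" for t
    by (simp add: zless_nat_conj less_ceiling_iff nat_less_iff) linarith
  then show ?thesis
    using sums_If_finite_set[of "{..<nat \<lceil>x\<rceil>}" "\<lambda>_. 1 :: real"] by (simp add: of_bool_def)
qed

lemma gaussian_tail_le_tangent: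
  fixes p q s t x :: real
  assumes q: "q > 0" and x: "x > 0" and s: "0 < s" "s < 1" and p_le_1: "p \<le> 1"
    and tail: "x \<le> t \<Longrightarrow> p \<le> 1/2 * exp (- (q * (t - x)\<^sup>2 / t))"
  shows "p \<le> 1/2 * of_bool (t < x)
    + 1/2 * min 1 (exp (- ((2 * s - s\<^sup>2) * q * (t - 2 * x / (2 - s)))))"
proof (cases "t < x")
  case True
  have "(2 * s - s\<^sup>2) * q \<ge> 0" using q s by (simp add: power2_eq_square)
  moreover have "x \<le> 2 * x / (2 - s)" using s x by (simp add: field_simps)
  ultimately have "(2 * s - s\<^sup>2) * q * (t - 2 * x / (2 - s)) \<le> 0"
    using True by (intro mult_nonneg_nonpos) auto
  then show ?thesis using p_le_1 True by simp
next
  case False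
  then have "t > 0" using x by linarith
  then have "exp (- (q * (t - x)\<^sup>2 / t))
      \<le> min 1 (exp (- ((2 * s - s\<^sup>2) * q * (t - 2 * x / (2 - s)))))"
    using exp_gaussian_exponent_le_tangent[of q t s x] q s by simp
  moreover have "p \<le> 1/2 * exp (- (q * (t - x)\<^sup>2 / t))" using tail False by simp
  moreover have "of_bool (t < x) = (0 :: real)" using False by simp
  ultimately show ?thesis by linarith
qed

lemma suminf_gaussian_tail_le_tangent:
  fixes q x s :: real and p :: "nat \<Rightarrow> real"
  assumes q: "q > 0" and x: "x > 0" and s: "0 < s" "s < 1"
    and p: "\<And>t. 0 \<le> p t" "\<And>t. p t \<le> 1"
      "\<And>t. x \<le> real t \<Longrightarrow> p t \<le> 1/2 * exp (- (q * (real t - x)\<^sup>2 / real t))"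
  shows "summable p"
    and "suminf p \<le> (1/2 + 1 / (2 - s)) * x
      + (1/2 + 1/2 * (1 / (1 - exp (- ((2 * s - s\<^sup>2) * q)))))"
proof -
  define c where "c = (2 * s - s\<^sup>2) * q"
  define \<tau> where "\<tau> = 2 * x / (2 - s)"
  define g where "g t = min 1 (exp (- (c * (real t - \<tau>))))" for t :: nat
  define d :: "nat \<Rightarrow> real" where "d t = of_bool (real t < x)" for t
  have p_le: "p t \<le> 1/2 * d t + 1/2 * g t" for t
    unfolding d_def g_def c_def \<tau>_def by (rule gaussian_tail_le_tangent[OF q x s p(2,3)])
  have "c > 0" "\<tau> \<ge> 0"
    unfolding c_def \<tau>_def using q s x by (simp_all add: power2_eq_square)
  then have g: "summable g" "suminf g \<le> \<tau> + 1 / (1 - exp (- c))"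
    using suminf_min_one_exp_le[of c \<tau>] by (auto simp: g_def[abs_def])
  have d: "d sums real (nat \<lceil>x\<rceil>)"
    unfolding d_def using x by (intro sums_of_bool_less) simp
  have "(\<lambda>t. 1/2 * d t + 1/2 * g t) sums (1/2 * real (nat \<lceil>x\<rceil>) + 1/2 * suminf g)"
    using d g(1) by (intro sums_add sums_mult summable_sums)
  then have dominating: "summable (\<lambda>t. 1/2 * d t + 1/2 * g t)"
    "(\<Sum>t. 1/2 * d t + 1/2 * g t) = 1/2 * real (nat \<lceil>x\<rceil>) + 1/2 * suminf g"
    by (simp_all add: sums_iff)
  show "summable p"
    by (rule summable_comparison_test'[OF dominating(1), of 0]) (use p(1) p_le in auto)
  then have "suminf p \<le> 1/2 * real (nat \<lceil>x\<rceil>) + 1/2 * suminf g"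
    unfolding dominating(2)[symmetric] using p_le dominating(1) by (intro suminf_le)
  also have "\<dots> \<le> 1/2 * (x + 1) + 1/2 * (\<tau> + 1 / (1 - exp (- c)))"
  proof (intro add_mono mult_left_mono)
    show "real (nat \<lceil>x\<rceil>) \<le> x + 1" using x by linarith
  qed (use g(2) in auto)
  also have "\<dots> = (1/2 + 1 / (2 - s)) * x + (1/2 + 1/2 * (1 / (1 - exp (- c))))"
    by (simp add: \<tau>_def algebra_simps)
  finally show "suminf p \<le> (1/2 + 1 / (2 - s)) * x
      + (1/2 + 1/2 * (1 / (1 - exp (- ((2 * s - s\<^sup>2) * q)))))"
    by (simp add: c_def)
qed

text \<open>
  With \<open>s = 2/3\<close> the coefficient of \<open>x\<close> is already \<open>5/4\<close>, and the remaining constants compare as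
  long as \<open>exp (- q / 9)\<close> stays above \<open>1/2\<close>, that is, for \<open>q < 9 * ln 2\<close>. For larger \<open>q\<close> the choice
  \<open>s = 1/2\<close> leaves a multiple of \<open>x\<close> to spare. The cut at \<open>31/5\<close> is just below \<open>9 * ln 2\<close>.
\<close>

lemma power9_le_double_minus_1:
  fixes u :: real
  assumes "203/405 \<le> u" "u \<le> 1"
  shows "u ^ 9 \<le> 2 * u - 1"
proof -
  let ?G = "\<lambda>v :: real. v + v^2 + v^3 + v^4 + v^5 + v^6 + v^7 + v^8"
  have "1 \<le> ?G (203/405)"
    by (simp add: power_divide)
  also have "\<dots> \<le> ?G u"
    using assms(1) by (intro add_mono power_mono) auto
  finally have "0 \<le> (1 - u) * (?G u - 1)"
    using assms(2) by simp
  also have "\<dots> = 2 * u - 1 - u ^ 9" by (simp add: algebra_simps eval_nat_numeral)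
  finally show ?thesis by simp
qed

lemma half_geometric_le:
  fixes q :: real
  assumes "0 < q" "q \<le> 31/5"
  shows "1/2 + 1/2 * (1 / (1 - exp (- (8/9 * q)))) \<le> 1 / (1 - exp (- q))"
proof -
  define u where "u = exp (- (q/9))"
  have u: "0 < u" "u < 1" using assms by (auto simp: u_def)
  have u_powers: "exp (- (8/9 * q)) = u ^ 8" "exp (- q) = u ^ 9"
    by (simp_all add: u_def flip: exp_of_nat_mult)
  have "(56/81 :: real) \<le> ln 2"
    using ln_approx_bounds[of 2 2] by (simp add: eval_nat_numeral)
  then have "406/405 \<le> 1 + (ln 2 - q/9)" using assms by simp
  also have "\<dots> \<le> exp (ln 2 - q/9)" by (rule exp_ge_add_one_self)
  also have "\<dots> = 2 * u" by (simp only: u_def diff_conv_add_uminus exp_add) simp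
  finally have "u ^ 9 \<le> 2 * u - 1"
    using u by (intro power9_le_double_minus_1) auto
  then have "u ^ 8 * u ^ 9 \<le> u ^ 8 * (2 * u - 1)"
    using u by (intro mult_left_mono) auto
  then have "u ^ 8 * (1 - u ^ 9) \<le> 2 * u ^ 9 * (1 - u ^ 8)"
    by (simp add: algebra_simps eval_nat_numeral)
  moreover have "u ^ 8 < 1" "u ^ 9 < 1" using u by (auto simp: power_less_one_iff)
  ultimately show ?thesis unfolding u_powers by (simp add: field_simps)
qed

lemma exp_ge_21_mult_plus_1:
  fixes p :: real
  assumes "p \<ge> 93/20"
  shows "21 * p + 1 \<le> exp p"
proof -
  have "(86 :: real) \<le> (5/4) ^ 20" by (simp add: power_divide)
  also have "\<dots> \<le> (1 + 9/40 + (9/40)\<^sup>2 / 2) ^ 20"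
    by (rule power_mono) (simp_all add: power2_eq_square)
  also have "\<dots> \<le> exp (9/40) ^ 20"
    by (intro power_mono exp_lower_Taylor_quadratic) auto
  also have "\<dots> = exp (9/2)" by (simp flip: exp_of_nat_mult)
  finally have "86 * (1 + (p - 9/2)) \<le> exp (9/2) * exp (p - 9/2)"
    using assms by (intro mult_mono exp_ge_add_one_self) auto
  then show ?thesis using assms by (simp flip: exp_add)
qed

lemma half_geometric_le_slack:
  fixes q x :: real
  assumes q: "q \<ge> 31/5" and x: "2/7 * ln 4 \<le> q * x"
  shows "1/2 + 1/2 * (1 / (1 - exp (- (3/4 * q)))) \<le> 1/12 * x + 1 / (1 - exp (- q))"
proof -
  define p where "p = 3/4 * q"
  have p: "p \<ge> 93/20" using q by (simp add: p_def)
  have exp_p: "21 * p \<le> exp p - 1" using exp_ge_21_mult_plus_1[OF p] by linarith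
  have "ln (4::real) = 2 * ln 2" using ln_realpow[of 2 2] by simp
  then have "8/21 \<le> q * x" using x ln2_ge_two_thirds by simp
  then have "2/7 \<le> x * p" by (simp add: p_def mult.commute)
  then have x_ge: "2/7 / p \<le> x" using p by (simp add: pos_divide_le_eq)
  have "1 / (1 - exp (- p)) = 1 + 1 / (exp p - 1)"
    using exp_p p by (simp add: exp_minus field_simps)
  also have "\<dots> \<le> 1 + 1 / (21 * p)"
    using exp_p p by (intro add_left_mono divide_left_mono) auto
  also have "\<dots> = 1 + 1/6 * (2/7 / p)" using p by (simp add: field_simps)
  finally have "1/2 + 1/2 * (1 / (1 - exp (- p))) \<le> 1/12 * x + 1" using x_ge by linarith
  moreover have "1 \<le> 1 / (1 - exp (- q))" using q by simp
  ultimately show ?thesis by (simp add: p_def)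
qed

lemma suminf_gaussian_tail_le:
  fixes q x :: real and p :: "nat \<Rightarrow> real"
  assumes q: "q > 0" and x: "2/7 * ln 4 \<le> q * x"
    and p: "\<And>t. 0 \<le> p t" "\<And>t. p t \<le> 1"
      "\<And>t. x \<le> real t \<Longrightarrow> p t \<le> 1/2 * exp (- (q * (real t - x)\<^sup>2 / real t))"
  shows "summable p" and "suminf p \<le> 5/4 * x + 1 / (1 - exp (- q))"
proof -
  have "0 < q * x" using x by (rule less_le_trans[rotated]) simp
  then have x_pos: "x > 0" using q by (simp add: zero_less_mult_iff)
  show "summable p"
    by (rule suminf_gaussian_tail_le_tangent[of q x "1/2" p]) (use q x_pos p in auto)
  show "suminf p \<le> 5/4 * x + 1 / (1 - exp (- q))"
  proof (cases "q \<le> 31/5")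
    case True
    have "suminf p \<le> (1/2 + 1 / (2 - 2/3)) * x
        + (1/2 + 1/2 * (1 / (1 - exp (- ((2 * (2/3) - (2/3)\<^sup>2) * q)))))"
      by (rule suminf_gaussian_tail_le_tangent) (use q x_pos p in auto)
    also have "\<dots> = 5/4 * x + (1/2 + 1/2 * (1 / (1 - exp (- (8/9 * q)))))"
      by (simp add: power2_eq_square)
    also have "\<dots> \<le> 5/4 * x + 1 / (1 - exp (- q))"
      using half_geometric_le[OF q True] by (rule add_left_mono)
    finally show ?thesis .
  next
    case False
    have "suminf p \<le> (1/2 + 1 / (2 - 1/2)) * x
        + (1/2 + 1/2 * (1 / (1 - exp (- ((2 * (1/2) - (1/2)\<^sup>2) * q)))))"
      by (rule suminf_gaussian_tail_le_tangent) (use q x_pos p in auto)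
    also have "\<dots> = 7/6 * x + (1/2 + 1/2 * (1 / (1 - exp (- (3/4 * q)))))"
      by (simp add: power2_eq_square)
    also have "\<dots> \<le> 7/6 * x + (1/12 * x + 1 / (1 - exp (- q)))"
      using half_geometric_le_slack[OF _ x] False by (intro add_left_mono) simp
    finally show ?thesis by simp
  qed
qed

section \<open>Normal random variables\<close>

lemma nn_integral_normal_density_lower_half:
  fixes g s :: real
  assumes s: "s > 0"
  shows "(\<integral>\<^sup>+x. ennreal (normal_density g s x) * indicator {..g} x \<partial>lborel) = ennreal (1/2)"
proof -
  define lower where "lower = (\<integral>\<^sup>+x. ennreal (normal_density g s x) * indicator {..g} x \<partial>lborel)"
  define upper where "upper = (\<integral>\<^sup>+x. ennreal (normal_density g s x) * indicator {g..} x \<partial>lborel)"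
  have "upper = (\<integral>\<^sup>+x. ennreal (normal_density g s (2 * g + (-1) * x))
      * indicator {g..} (2 * g + (-1) * x) \<partial>lborel)"
    unfolding upper_def by (subst nn_integral_real_affine[where c="-1" and t="2*g"]) auto
  also have "\<dots> = lower"
    unfolding lower_def by (intro nn_integral_cong)
      (auto simp: normal_density_def power2_commute indicator_def)
  finally have upper_eq: "upper = lower" .
  have "AE x in lborel. x \<noteq> g" by (rule AE_lborel_singleton)
  then have "lower + upper = (\<integral>\<^sup>+x. ennreal (normal_density g s x) \<partial>lborel)"
    unfolding lower_def upper_def
    by (subst nn_integral_add[symmetric]) (auto intro!: nn_integral_cong_AE simp: indicator_def)
  also have "\<dots> = 1"
    using s by (subst nn_integral_eq_integral) auto
  finally have double: "lower + lower = 1" by (simp add: upper_eq)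
  then have "lower \<noteq> \<top>" by auto
  then obtain a where a: "lower = ennreal a" "a \<ge> 0" by (cases lower) auto
  then have "a + a = 1" using double by (simp flip: ennreal_plus ennreal_1)
  then have "a = 1/2" by simp
  then show ?thesis using a(1) unfolding lower_def by (simp only:)
qed

lemma normal_density_le_shifted:
  fixes \<nu> g s x :: real
  assumes "x \<le> g" "g \<le> \<nu>"
  shows "normal_density \<nu> s x \<le> exp (- ((\<nu> - g)\<^sup>2 / (2 * s\<^sup>2))) * normal_density g s x"
proof -
  have "0 \<le> (g - x) * (\<nu> - g)" using assms by simp
  then have "(\<nu> - g)\<^sup>2 + (x - g)\<^sup>2 \<le> (x - \<nu>)\<^sup>2"
    by (simp add: power2_eq_square algebra_simps)
  then have "((\<nu> - g)\<^sup>2 + (x - g)\<^sup>2) / (2 * s\<^sup>2) \<le> (x - \<nu>)\<^sup>2 / (2 * s\<^sup>2)"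
    by (rule divide_right_mono) simp
  then have "exp (- (x - \<nu>)\<^sup>2 / (2 * s\<^sup>2))
      \<le> exp (- ((\<nu> - g)\<^sup>2 / (2 * s\<^sup>2))) * exp (- (x - g)\<^sup>2 / (2 * s\<^sup>2))"
    by (simp add: add_divide_distrib flip: exp_add)
  then have "1 / sqrt (2 * pi * s\<^sup>2) * exp (- (x - \<nu>)\<^sup>2 / (2 * s\<^sup>2))
      \<le> 1 / sqrt (2 * pi * s\<^sup>2) * (exp (- ((\<nu> - g)\<^sup>2 / (2 * s\<^sup>2))) * exp (- (x - g)\<^sup>2 / (2 * s\<^sup>2)))"
    by (rule mult_left_mono) simp
  then show ?thesis unfolding normal_density_def by (simp add: ac_simps)
qed

lemma (in prob_space) normal_lower_tail:
  assumes X: "distributed M lborel X (normal_density \<nu> s)" and s: "s > 0" and g: "g \<le> \<nu>"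
  shows "prob {\<omega> \<in> space M. X \<omega> \<le> g} \<le> 1/2 * exp (- ((\<nu> - g)\<^sup>2 / (2 * s\<^sup>2)))"
proof -
  define e where "e = exp (- ((\<nu> - g)\<^sup>2 / (2 * s\<^sup>2)))"
  have e: "0 \<le> e" by (simp add: e_def)
  have density_le: "normal_density \<nu> s x \<le> e * normal_density g s x" if "x \<le> g" for x
    unfolding e_def using that g by (rule normal_density_le_shifted)
  have "{\<omega> \<in> space M. X \<omega> \<le> g} = X -` {..g} \<inter> space M" by auto
  then have "emeasure M {\<omega> \<in> space M. X \<omega> \<le> g}
      = (\<integral>\<^sup>+x. ennreal (normal_density \<nu> s x) * indicator {..g} x \<partial>lborel)"
    using distributed_emeasure[OF X, of "{..g}"] by simp
  also have "\<dots> \<le> (\<integral>\<^sup>+x. ennreal e * (ennreal (normal_density g s x) * indicator {..g} x) \<partial>lborel)"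
    by (intro nn_integral_mono)
      (auto simp: indicator_def density_le e simp flip: ennreal_mult intro!: ennreal_leI)
  also have "\<dots> = ennreal e * ennreal (1/2)"
    using nn_integral_normal_density_lower_half[OF s, of g] by (simp add: nn_integral_cmult)
  also have "\<dots> = ennreal (1/2 * e)"
    using e by (subst mult.commute, intro ennreal_mult[symmetric]) auto
  finally show ?thesis unfolding e_def[symmetric]
    by (simp add: emeasure_eq_measure e_def)
qed

lemma (in prob_space) normal_linear_combination:
  fixes X :: "'i \<Rightarrow> 'a \<Rightarrow> real"
  assumes I: "finite I" and indep: "indep_vars (\<lambda>_. borel) X I"
    and s: "\<And>i. i \<in> I \<Longrightarrow> s i > 0"
    and X: "\<And>i. i \<in> I \<Longrightarrow> distributed M lborel (X i) (normal_density (\<nu> i) (s i))"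
    and a: "\<exists>i\<in>I. a i \<noteq> 0"
  shows "distributed M lborel (\<lambda>\<omega>. \<Sum>i\<in>I. a i * X i \<omega>)
    (normal_density (\<Sum>i\<in>I. a i * \<nu> i) (sqrt (\<Sum>i\<in>I. (a i)\<^sup>2 * (s i)\<^sup>2)))"
proof -
  define J where "J = {i \<in> I. a i \<noteq> 0}"
  have J: "finite J" "J \<subseteq> I" "J \<noteq> {}" using I a by (auto simp: J_def)
  have "distributed M lborel (\<lambda>\<omega>. \<Sum>i\<in>J. a i * X i \<omega>)
      (normal_density (\<Sum>i\<in>J. a i * \<nu> i) (sqrt (\<Sum>i\<in>J. (\<bar>a i\<bar> * s i)\<^sup>2)))"
  proof (rule sum_indep_normal)
    show "indep_vars (\<lambda>_. borel) (\<lambda>i \<omega>. a i * X i \<omega>) J"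
      by (rule indep_vars_compose2[OF indep_vars_subset[OF indep J(2)]]) auto
    show "distributed M lborel (\<lambda>\<omega>. a i * X i \<omega>) (normal_density (a i * \<nu> i) (\<bar>a i\<bar> * s i))"
      if "i \<in> J" for i
      using normal_density_affine[OF X s, of i "a i" 0] that by (auto simp: J_def)
  qed (use J s in \<open>auto simp: J_def\<close>)
  also have "(\<lambda>\<omega>. \<Sum>i\<in>J. a i * X i \<omega>) = (\<lambda>\<omega>. \<Sum>i\<in>I. a i * X i \<omega>)"
    using I by (intro ext sum.mono_neutral_left) (auto simp: J_def)
  also have "(\<Sum>i\<in>J. a i * \<nu> i) = (\<Sum>i\<in>I. a i * \<nu> i)"
    using I by (intro sum.mono_neutral_left) (auto simp: J_def)
  also have "(\<Sum>i\<in>J. (\<bar>a i\<bar> * s i)\<^sup>2) = (\<Sum>i\<in>I. (a i)\<^sup>2 * (s i)\<^sup>2)"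
    using I by (intro sum.mono_neutral_cong_left) (auto simp: J_def power_mult_distrib)
  finally show ?thesis .
qed

lemma normal_density_mult_exp:
  fixes c s x \<nu> :: real
  assumes "s > 0"
  shows "normal_density \<nu> s x * exp (c * x)
    = exp (c * \<nu> + c\<^sup>2 * s\<^sup>2 / 2) * normal_density (\<nu> + c * s\<^sup>2) s x"
proof -
  have "- (x - \<nu>)\<^sup>2 / (2 * s\<^sup>2) + c * x
      = c * \<nu> + c\<^sup>2 * s\<^sup>2 / 2 + - (x - (\<nu> + c * s\<^sup>2))\<^sup>2 / (2 * s\<^sup>2)"
    using assms by (simp add: field_simps) (simp add: eval_nat_numeral algebra_simps)
  then have "exp (- (x - \<nu>)\<^sup>2 / (2 * s\<^sup>2)) * exp (c * x)
      = exp (c * \<nu> + c\<^sup>2 * s\<^sup>2 / 2) * exp (- (x - (\<nu> + c * s\<^sup>2))\<^sup>2 / (2 * s\<^sup>2))"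
    by (simp only: flip: exp_add)
  then show ?thesis unfolding normal_density_def by simp
qed

lemma (in prob_space) normal_exponential_moment:
  assumes X: "distributed M lborel X (normal_density \<nu> s)" and s: "s > 0"
  shows "has_bochner_integral M (\<lambda>\<omega>. exp (c * X \<omega>)) (exp (c * \<nu> + c\<^sup>2 * s\<^sup>2 / 2))"
proof -
  have "integrable M (\<lambda>\<omega>. exp (c * X \<omega>))"
    using distributed_integrable[OF X, of "\<lambda>x. exp (c * x)"] s
    by (simp add: normal_density_mult_exp)
  moreover have "expectation (\<lambda>\<omega>. exp (c * X \<omega>)) = exp (c * \<nu> + c\<^sup>2 * s\<^sup>2 / 2)"
    using distributed_integral[OF X, of "\<lambda>x. exp (c * x)"] s by (simp add: normal_density_mult_exp)
  ultimately show ?thesis by (simp add: has_bochner_integral_iff)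
qed

lemma nn_integral_normal_exp_tilt:
  fixes c s \<nu> :: real
  assumes s: "s > 0" and f [measurable]: "f \<in> borel_measurable borel"
  shows "(\<integral>\<^sup>+x. ennreal (exp (c * x)) * f x \<partial>density lborel (normal_density \<nu> s))
    = ennreal (exp (c * \<nu> + c\<^sup>2 * s\<^sup>2 / 2))
      * (\<integral>\<^sup>+x. f (x + c * s\<^sup>2) \<partial>density lborel (normal_density \<nu> s))"
proof -
  define \<nu>' where "\<nu>' = \<nu> + c * s\<^sup>2"
  have "(\<integral>\<^sup>+x. ennreal (exp (c * x)) * f x \<partial>density lborel (normal_density \<nu> s))
      = (\<integral>\<^sup>+x. ennreal (normal_density \<nu> s x * exp (c * x)) * f x \<partial>lborel)"
    by (simp add: nn_integral_density ennreal_mult mult.assoc)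
  also have "\<dots> = ennreal (exp (c * \<nu> + c\<^sup>2 * s\<^sup>2 / 2))
      * (\<integral>\<^sup>+x. ennreal (normal_density \<nu>' s x) * f x \<partial>lborel)"
    unfolding normal_density_mult_exp[OF s] \<nu>'_def
    by (simp add: ennreal_mult mult.assoc nn_integral_cmult)
  also have "(\<integral>\<^sup>+x. ennreal (normal_density \<nu>' s x) * f x \<partial>lborel)
      = (\<integral>\<^sup>+x. ennreal (normal_density \<nu>' s (c * s\<^sup>2 + 1 * x)) * f (c * s\<^sup>2 + 1 * x) \<partial>lborel)"
    by (subst nn_integral_real_affine[where c=1 and t="c * s\<^sup>2"]) auto
  also have "\<dots> = (\<integral>\<^sup>+x. f (x + c * s\<^sup>2) \<partial>density lborel (normal_density \<nu> s))"
    by (simp add: nn_integral_density \<nu>'_def normal_density_def add.commute)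
  finally show ?thesis .
qed

lemma nn_integral_fun_upd_normal_exp_tilt:
  fixes c x :: "'i \<Rightarrow> real"
  assumes s: "s > 0" and I: "finite I" "j \<notin> I" and x: "x \<in> space (PiM I (\<lambda>_. borel))"
    and f: "f \<in> borel_measurable (PiM (insert j I) (\<lambda>_. borel))"
  shows "(\<integral>\<^sup>+y. ennreal (exp (\<Sum>i\<in>insert j I. c i * (x(j := y)) i)) * f (x(j := y))
      \<partial>density lborel (normal_density \<nu> s))
    = ennreal (exp (c j * \<nu> + (c j)\<^sup>2 * s\<^sup>2 / 2)) * (ennreal (exp (\<Sum>i\<in>I. c i * x i))
      * (\<integral>\<^sup>+y. f (x(j := y + c j * s\<^sup>2)) \<partial>density lborel (normal_density \<nu> s)))"
    (is "?lhs = ?Z * (?rest * ?shifted)")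
proof -
  have [measurable]: "(\<lambda>y. f (x(j := y))) \<in> borel_measurable borel"
    by (rule measurable_compose[OF measurable_component_update[OF x I(2)] f])
  have "(\<Sum>i\<in>insert j I. c i * (x(j := y)) i) = (\<Sum>i\<in>I. c i * x i) + c j * y" for y
  proof -
    have "(\<Sum>i\<in>I. c i * (x(j := y)) i) = (\<Sum>i\<in>I. c i * x i)"
      using I by (intro sum.cong) auto
    then show ?thesis using I by simp
  qed
  then have "?lhs = (\<integral>\<^sup>+y. ?rest * (ennreal (exp (c j * y)) * f (x(j := y)))
      \<partial>density lborel (normal_density \<nu> s))"
    by (simp add: exp_add ennreal_mult mult.assoc)
  also have "\<dots> = ?rest * (\<integral>\<^sup>+y. ennreal (exp (c j * y)) * f (x(j := y))
      \<partial>density lborel (normal_density \<nu> s))"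
    by (rule nn_integral_cmult) measurable
  also have "(\<integral>\<^sup>+y. ennreal (exp (c j * y)) * f (x(j := y)) \<partial>density lborel (normal_density \<nu> s))
      = ?Z * ?shifted"
    by (rule nn_integral_normal_exp_tilt[OF s]) measurable
  finally show ?thesis by (simp only: mult_ac)
qed

text \<open>The discrete form of the Cameron--Martin theorem.\<close>

lemma nn_integral_PiM_normal_exp_tilt:
  fixes c :: "'i \<Rightarrow> real" and \<nu> s :: real
  defines "D \<equiv> density lborel (normal_density \<nu> s)"
  assumes s: "s > 0" and I: "finite I" and f: "f \<in> borel_measurable (PiM I (\<lambda>_. borel))"
  shows "(\<integral>\<^sup>+x. ennreal (exp (\<Sum>i\<in>I. c i * x i)) * f x \<partial>PiM I (\<lambda>_. D))
    = ennreal (exp (\<Sum>i\<in>I. c i * \<nu> + (c i)\<^sup>2 * s\<^sup>2 / 2))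
      * (\<integral>\<^sup>+x. f (\<lambda>i\<in>I. x i + c i * s\<^sup>2) \<partial>PiM I (\<lambda>_. D))"
  using I f
proof (induction I arbitrary: f rule: finite_induct)
  case empty
  then show ?case by (simp add: restrict_def PiM_empty nn_integral_count_space_finite)
next
  case (insert j I)
  interpret D: prob_space D unfolding D_def by (rule prob_space_normal_density[OF s])
  interpret product_sigma_finite "\<lambda>_. D" by unfold_locales
  have sets_D: "sets D = sets borel" by (simp add: D_def)
  have sets_PiM: "sets (PiM J (\<lambda>_. D)) = sets (PiM J (\<lambda>_. borel))" for J :: "'i set"
    by (intro sets_PiM_cong) (simp_all add: sets_D)
  note [measurable_cong] = sets_D sets_PiM
  note [measurable] = insert.prems
  define Z where "Z = exp (c j * \<nu> + (c j)\<^sup>2 * s\<^sup>2 / 2)"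
  define F where "F x = (\<integral>\<^sup>+y. f (x(j := y + c j * s\<^sup>2)) \<partial>D)" for x
  have F: "F \<in> borel_measurable (PiM I (\<lambda>_. borel))"
    unfolding F_def by measurable
  have "(\<integral>\<^sup>+x. ennreal (exp (\<Sum>i\<in>insert j I. c i * x i)) * f x \<partial>PiM (insert j I) (\<lambda>_. D))
      = (\<integral>\<^sup>+x. \<integral>\<^sup>+y. ennreal (exp (\<Sum>i\<in>insert j I. c i * (x(j := y)) i)) * f (x(j := y))
        \<partial>D \<partial>PiM I (\<lambda>_. D))"
    using insert.hyps by (intro product_nn_integral_insert) auto
  also have "\<dots> = (\<integral>\<^sup>+x. ennreal Z * (ennreal (exp (\<Sum>i\<in>I. c i * x i)) * F x) \<partial>PiM I (\<lambda>_. D))"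
    unfolding Z_def F_def D_def using insert.hyps insert.prems
    by (intro nn_integral_cong nn_integral_fun_upd_normal_exp_tilt[OF s]) (simp_all add: space_PiM)
  also have "\<dots> = ennreal Z * (\<integral>\<^sup>+x. ennreal (exp (\<Sum>i\<in>I. c i * x i)) * F x \<partial>PiM I (\<lambda>_. D))"
    using F by (intro nn_integral_cmult) measurable
  also have "(\<integral>\<^sup>+x. ennreal (exp (\<Sum>i\<in>I. c i * x i)) * F x \<partial>PiM I (\<lambda>_. D))
      = ennreal (exp (\<Sum>i\<in>I. c i * \<nu> + (c i)\<^sup>2 * s\<^sup>2 / 2))
        * (\<integral>\<^sup>+x. F (\<lambda>i\<in>I. x i + c i * s\<^sup>2) \<partial>PiM I (\<lambda>_. D))"
    by (rule insert.IH[OF F])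
  also have "(\<integral>\<^sup>+x. F (\<lambda>i\<in>I. x i + c i * s\<^sup>2) \<partial>PiM I (\<lambda>_. D))
      = (\<integral>\<^sup>+x. \<integral>\<^sup>+y. f (\<lambda>i\<in>insert j I. (x(j := y)) i + c i * s\<^sup>2) \<partial>D \<partial>PiM I (\<lambda>_. D))"
    unfolding F_def using insert.hyps
    by (intro nn_integral_cong arg_cong[where f=f]) (auto simp: fun_eq_iff restrict_def)
  also have "\<dots> = (\<integral>\<^sup>+x. f (\<lambda>i\<in>insert j I. x i + c i * s\<^sup>2) \<partial>PiM (insert j I) (\<lambda>_. D))"
    using insert.hyps by (intro product_nn_integral_insert[symmetric]) auto
  also have "ennreal Z * (ennreal (exp (\<Sum>i\<in>I. c i * \<nu> + (c i)\<^sup>2 * s\<^sup>2 / 2)) * A)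
      = ennreal (exp (\<Sum>i\<in>insert j I. c i * \<nu> + (c i)\<^sup>2 * s\<^sup>2 / 2)) * A" for A
    using insert.hyps by (simp add: Z_def exp_add ennreal_mult mult.assoc)
  finally show ?case .
qed

lemma (in prob_space) nn_integral_indep_normal_exp_tilt:
  fixes X :: "'i \<Rightarrow> 'a \<Rightarrow> real"
  assumes s: "s > 0" and I: "finite I" and indep: "indep_vars (\<lambda>_. borel) X I"
    and X: "\<And>i. i \<in> I \<Longrightarrow> distributed M lborel (X i) (normal_density \<nu> s)"
    and f [measurable]: "f \<in> borel_measurable (PiM I (\<lambda>_. borel))"
  shows "(\<integral>\<^sup>+\<omega>. ennreal (exp (\<Sum>i\<in>I. c i * X i \<omega>)) * f (\<lambda>i\<in>I. X i \<omega>) \<partial>M)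
    = ennreal (exp (\<Sum>i\<in>I. c i * \<nu> + (c i)\<^sup>2 * s\<^sup>2 / 2)) * (\<integral>\<^sup>+\<omega>. f (\<lambda>i\<in>I. X i \<omega> + c i * s\<^sup>2) \<partial>M)"
proof (cases "I = {}")
  case True
  then show ?thesis by (simp add: restrict_def emeasure_space_1)
next
  case False
  let ?D = "density lborel (normal_density \<nu> s)"
  have X_meas [measurable]: "X i \<in> borel_measurable M" if "i \<in> I" for i
    using distributed_measurable[OF X[OF that]] by simp
  have "distr M borel (X i) = ?D" if "i \<in> I" for i
    using distributed_distr_eq_density[OF X[OF that]] by (simp cong: distr_cong)
  then have "PiM I (\<lambda>_. ?D) = PiM I (\<lambda>i. distr M borel (X i))"
    by (intro PiM_cong) auto
  also have "\<dots> = distr M (PiM I (\<lambda>_. borel)) (\<lambda>\<omega>. \<lambda>i\<in>I. X i \<omega>)"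
    using indep_vars_iff_distr_eq_PiM'[OF False, where M'="\<lambda>_. borel" and X=X] indep X_meas by simp
  finally have PiM_eq: "PiM I (\<lambda>_. ?D) = distr M (PiM I (\<lambda>_. borel)) (\<lambda>\<omega>. \<lambda>i\<in>I. X i \<omega>)" .
  have integral_PiM: "(\<integral>\<^sup>+x. g x \<partial>PiM I (\<lambda>_. ?D)) = (\<integral>\<^sup>+\<omega>. g (\<lambda>i\<in>I. X i \<omega>) \<partial>M)"
    if [measurable]: "g \<in> borel_measurable (PiM I (\<lambda>_. borel))" for g :: "('i \<Rightarrow> real) \<Rightarrow> ennreal"
    unfolding PiM_eq by (rule nn_integral_distr) measurable
  show ?thesis
    using nn_integral_PiM_normal_exp_tilt[OF s I f, where c=c and \<nu>=\<nu>]
    by (simp add: integral_PiM cong: restrict_cong)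
qed

section \<open>Occupation of a half-line by a random walk\<close>

lemma (in prob_space) has_bochner_integral_past_mult_next:
  fixes F :: "(nat \<Rightarrow> 'b::topological_space) \<Rightarrow> real" and g :: "'b \<Rightarrow> real"
  assumes indep: "indep_vars (\<lambda>_. borel) X {1..}"
    and F: "F \<in> borel_measurable (PiM {1..t} (\<lambda>_. borel))" "integrable M (\<lambda>\<omega>. F (\<lambda>j\<in>{1..t}. X j \<omega>))"
    and g: "g \<in> borel_measurable borel" "integrable M (\<lambda>\<omega>. g (X (Suc t) \<omega>))"
  shows "has_bochner_integral M (\<lambda>\<omega>. F (\<lambda>j\<in>{1..t}. X j \<omega>) * g (X (Suc t) \<omega>))
    (expectation (\<lambda>\<omega>. F (\<lambda>j\<in>{1..t}. X j \<omega>)) * expectation (\<lambda>\<omega>. g (X (Suc t) \<omega>)))"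
proof -
  have "indep_var (PiM {1..t} (\<lambda>_. borel)) (\<lambda>\<omega>. \<lambda>j\<in>{1..t}. X j \<omega>)
      (PiM {Suc t} (\<lambda>_. borel)) (\<lambda>\<omega>. \<lambda>j\<in>{Suc t}. X j \<omega>)"
    by (rule indep_var_restrict[OF indep]) auto
  from indep_var_compose[OF this F(1), of "\<lambda>x. g (x (Suc t))" borel]
  have "indep_var borel (\<lambda>\<omega>. F (\<lambda>j\<in>{1..t}. X j \<omega>)) borel (\<lambda>\<omega>. g (X (Suc t) \<omega>))"
    using g(1) by (simp add: comp_def)
  then show ?thesis
    using F(2) g(2)
    by (simp add: has_bochner_integral_iff indep_var_integrable indep_var_lebesgue_integral)
qed

definition stays_below :: "real \<Rightarrow> nat \<Rightarrow> (nat \<Rightarrow> real) \<Rightarrow> bool" where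
  "stays_below \<gamma> t x \<longleftrightarrow> (\<forall>k\<le>t. (\<Sum>j\<in>{1..k}. x j) \<le> \<gamma>)"

lemma stays_below_cong:
  "(\<And>j. j \<in> {1..t} \<Longrightarrow> x j = y j) \<Longrightarrow> stays_below \<gamma> t x \<longleftrightarrow> stays_below \<gamma> t y"
  unfolding stays_below_def by (intro all_cong arg_cong2[where f="(\<le>)"] sum.cong) auto

lemma stays_below_restrict: "stays_below \<gamma> t (restrict x {1..t}) \<longleftrightarrow> stays_below \<gamma> t x"
  by (rule stays_below_cong) simp

lemma measurable_stays_below [measurable]:
  "Measurable.pred (PiM {1..t} (\<lambda>_. borel)) (stays_below \<gamma> t)"
  unfolding stays_below_def[abs_def] by measurable

text \<open>
  The occupation of the half-line is read off the drift of \<open>(1 - \<kappa> * exp (s - \<gamma>))\<^sup>2\<close>, where \<open>s\<close> is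
  the position of the walk. The square keeps this potential non-negative after an overshoot of \<open>\<gamma>\<close>.
\<close>

locale positive_drift_walk = prob_space M
  for M :: "'a measure" +
  fixes X :: "nat \<Rightarrow> 'a \<Rightarrow> real" and \<nu> b :: real
  assumes indep: "indep_vars (\<lambda>_. borel) X {1..}"
    and drift_pos: "\<nu> > 0"
    and mean: "t \<ge> 1 \<Longrightarrow> has_bochner_integral M (X t) \<nu>"
    and integrable_exp2: "t \<ge> 1 \<Longrightarrow> integrable M (\<lambda>\<omega>. exp (2 * X t \<omega>))"
    and expectation_exp2_le: "t \<ge> 1 \<Longrightarrow> expectation (\<lambda>\<omega>. exp (2 * X t \<omega>)) \<le> b"
begin

lemma measurable_increment [measurable]: "t \<ge> 1 \<Longrightarrow> X t \<in> borel_measurable M"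
  using mean by (rule borel_measurable_has_bochner_integral)

lemma one_plus_drift_le_exp2_bound: "1 + 2 * \<nu> \<le> b"
proof -
  have X: "integrable M (X 1)" "expectation (X 1) = \<nu>"
    using mean[of 1] by (auto simp: has_bochner_integral_iff)
  have "1 + 2 * \<nu> = expectation (\<lambda>\<omega>. 1 + 2 * X 1 \<omega>)" using X by (simp add: prob_space)
  also have "\<dots> \<le> expectation (\<lambda>\<omega>. exp (2 * X 1 \<omega>))"
    using X integrable_exp2[of 1] by (intro integral_mono exp_ge_add_one_self) auto
  also have "\<dots> \<le> b" using expectation_exp2_le[of 1] by simp
  finally show ?thesis .
qed

lemma
  assumes t: "t \<ge> 1"
  shows integrable_exp_increment: "integrable M (\<lambda>\<omega>. exp (X t \<omega>))"
    and one_plus_drift_le_expectation_exp: "1 + \<nu> \<le> expectation (\<lambda>\<omega>. exp (X t \<omega>))"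
proof -
  note [measurable] = measurable_increment[OF t]
  have X: "integrable M (X t)" "expectation (X t) = \<nu>"
    using mean[OF t] by (auto simp: has_bochner_integral_iff)
  have exp_le: "exp x \<le> 1 + exp (2 * x)" for x :: real
    by (cases "x \<le> 0") (auto simp: add_increasing add_increasing2)
  show int_exp: "integrable M (\<lambda>\<omega>. exp (X t \<omega>))"
  proof (rule Bochner_Integration.integrable_bound)
    show "integrable M (\<lambda>\<omega>. 1 + exp (2 * X t \<omega>))" using integrable_exp2[OF t] by simp
    show "AE \<omega> in M. norm (exp (X t \<omega>)) \<le> norm (1 + exp (2 * X t \<omega>))"
      by (intro AE_I2) (simp only: real_norm_def abs_exp_cancel order_trans[OF exp_le abs_ge_self])
  qed measurable
  have "expectation (\<lambda>\<omega>. 1 + X t \<omega>) \<le> expectation (\<lambda>\<omega>. exp (X t \<omega>))"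
    using X int_exp by (intro integral_mono) auto
  then show "1 + \<nu> \<le> expectation (\<lambda>\<omega>. exp (X t \<omega>))" using X by (simp add: prob_space)
qed

definition below :: "real \<Rightarrow> nat \<Rightarrow> 'a \<Rightarrow> real" where
  "below \<gamma> t \<omega> = of_bool (stays_below \<gamma> t (\<lambda>j. X j \<omega>))"

definition exp_excess :: "real \<Rightarrow> nat \<Rightarrow> 'a \<Rightarrow> real" where
  "exp_excess \<gamma> t \<omega> = exp ((\<Sum>j\<in>{1..t}. X j \<omega>) - \<gamma>)"

lemma measurable_below [measurable]: "below \<gamma> t \<in> borel_measurable M"
  unfolding below_def[abs_def] stays_below_def by measurable

lemma measurable_exp_excess [measurable]: "exp_excess \<gamma> t \<in> borel_measurable M"
  unfolding exp_excess_def[abs_def] by measurable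

lemma below_Suc_le: "below \<gamma> (Suc t) \<omega> \<le> below \<gamma> t \<omega>"
  by (simp add: below_def stays_below_def)

lemma exp_excess_le_1: "stays_below \<gamma> t (\<lambda>j. X j \<omega>) \<Longrightarrow> exp_excess \<gamma> t \<omega> \<le> 1"
  by (simp add: exp_excess_def stays_below_def)

lemma exp_excess_nonneg: "0 \<le> exp_excess \<gamma> t \<omega>"
  by (simp add: exp_excess_def)

lemma exp_excess_Suc: "exp_excess \<gamma> (Suc t) \<omega> = exp_excess \<gamma> t \<omega> * exp (X (Suc t) \<omega>)"
  by (simp add: exp_excess_def algebra_simps flip: exp_add)

lemma integrable_below: "integrable M (below \<gamma> t)"
  by (rule integrable_const_bound[where B=1]) (auto simp: below_def)

lemma integrable_exp_excess_power_below:
  "integrable M (\<lambda>\<omega>. exp_excess \<gamma> t \<omega> ^ n * below \<gamma> t \<omega>)"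
proof (rule integrable_const_bound)
  show "AE \<omega> in M. norm (exp_excess \<gamma> t \<omega> ^ n * below \<gamma> t \<omega>) \<le> 1"
    by (auto simp: below_def exp_excess_nonneg exp_excess_le_1 power_le_one)
qed measurable

lemma has_bochner_integral_exp_excess_power_next:
  assumes "integrable M (\<lambda>\<omega>. exp (c * X (Suc t) \<omega>))"
  shows "has_bochner_integral M (\<lambda>\<omega>. (exp_excess \<gamma> t \<omega> ^ n * below \<gamma> t \<omega>) * exp (c * X (Suc t) \<omega>))
    (expectation (\<lambda>\<omega>. exp_excess \<gamma> t \<omega> ^ n * below \<gamma> t \<omega>)
      * expectation (\<lambda>\<omega>. exp (c * X (Suc t) \<omega>)))"
proof -
  define F where "F x = exp ((\<Sum>j\<in>{1..t}. x j) - \<gamma>) ^ n * of_bool (stays_below \<gamma> t x)"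
    for x :: "nat \<Rightarrow> real"
  have F: "F (\<lambda>j\<in>{1..t}. X j \<omega>) = exp_excess \<gamma> t \<omega> ^ n * below \<gamma> t \<omega>" for \<omega>
    by (simp add: F_def exp_excess_def below_def stays_below_restrict[unfolded One_nat_def])
  have F_meas: "F \<in> borel_measurable (PiM {1..t} (\<lambda>_. borel))"
    unfolding F_def by measurable
  have "(\<lambda>x. exp (c * x)) \<in> borel_measurable borel" by measurable
  from has_bochner_integral_past_mult_next[OF indep F_meas, unfolded F,
      OF integrable_exp_excess_power_below this assms]
  show ?thesis .
qed

definition occupation :: "real \<Rightarrow> nat \<Rightarrow> real" where
  "occupation \<gamma> t = expectation (\<lambda>\<omega>. exp_excess \<gamma> t \<omega> * below \<gamma> t \<omega>)"

lemma occupation_nonneg: "0 \<le> occupation \<gamma> t"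
  unfolding occupation_def
  by (rule Bochner_Integration.integral_nonneg) (simp add: below_def exp_excess_nonneg)

definition square_potential :: "real \<Rightarrow> real \<Rightarrow> nat \<Rightarrow> real" where
  "square_potential \<kappa> \<gamma> t = expectation (\<lambda>\<omega>. (1 - \<kappa> * exp_excess \<gamma> t \<omega>)\<^sup>2 * below \<gamma> t \<omega>)"

lemma square_potential_nonneg: "0 \<le> square_potential \<kappa> \<gamma> t"
  unfolding square_potential_def by (rule Bochner_Integration.integral_nonneg) (simp add: below_def)

lemma square_potential_eq:
  "square_potential \<kappa> \<gamma> t = expectation (below \<gamma> t) - 2 * \<kappa> * occupation \<gamma> t
    + \<kappa>\<^sup>2 * expectation (\<lambda>\<omega>. (exp_excess \<gamma> t \<omega>)\<^sup>2 * below \<gamma> t \<omega>)"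
proof -
  have "(1 - \<kappa> * exp_excess \<gamma> t \<omega>)\<^sup>2 * below \<gamma> t \<omega> = below \<gamma> t \<omega>
      - 2 * \<kappa> * (exp_excess \<gamma> t \<omega> * below \<gamma> t \<omega>) + \<kappa>\<^sup>2 * ((exp_excess \<gamma> t \<omega>)\<^sup>2 * below \<gamma> t \<omega>)" for \<omega>
    by (simp add: power2_eq_square algebra_simps)
  then show ?thesis
    using integrable_below[of \<gamma> t] integrable_exp_excess_power_below[of \<gamma> t 1]
      integrable_exp_excess_power_below[of \<gamma> t 2]
    by (simp add: square_potential_def occupation_def)
qed

lemma square_potential_Suc_le:
  assumes \<kappa>: "0 \<le> \<kappa>"
  shows "square_potential \<kappa> \<gamma> (Suc t)
    \<le> expectation (below \<gamma> t) - 2 * \<kappa> * (occupation \<gamma> t * (1 + \<nu>))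
      + \<kappa>\<^sup>2 * (expectation (\<lambda>\<omega>. (exp_excess \<gamma> t \<omega>)\<^sup>2 * below \<gamma> t \<omega>) * b)"
proof -
  define Z where "Z n \<omega> = exp_excess \<gamma> t \<omega> ^ n * below \<gamma> t \<omega>" for n \<omega>
  have int_Z: "integrable M (Z n)" for n
    unfolding Z_def by (rule integrable_exp_excess_power_below)
  have Z_nonneg: "0 \<le> expectation (Z n)" for n
    by (rule Bochner_Integration.integral_nonneg) (simp add: Z_def below_def exp_excess_nonneg)
  have first_moment: "has_bochner_integral M (\<lambda>\<omega>. Z 1 \<omega> * exp (X (Suc t) \<omega>))
      (expectation (Z 1) * expectation (\<lambda>\<omega>. exp (X (Suc t) \<omega>)))"
    using has_bochner_integral_exp_excess_power_next[of 1 t \<gamma> 1]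
    by (simp add: Z_def[abs_def] integrable_exp_increment)
  have second_moment: "has_bochner_integral M (\<lambda>\<omega>. Z 2 \<omega> * exp (2 * X (Suc t) \<omega>))
      (expectation (Z 2) * expectation (\<lambda>\<omega>. exp (2 * X (Suc t) \<omega>)))"
    using has_bochner_integral_exp_excess_power_next[of 2 t \<gamma> 2]
    by (simp add: Z_def[abs_def] integrable_exp2)
  have expand: "(1 - \<kappa> * exp_excess \<gamma> (Suc t) \<omega>)\<^sup>2 * below \<gamma> t \<omega>
      = Z 0 \<omega> - 2 * \<kappa> * (Z 1 \<omega> * exp (X (Suc t) \<omega>)) + \<kappa>\<^sup>2 * (Z 2 \<omega> * exp (2 * X (Suc t) \<omega>))" for \<omega>
    by (simp add: Z_def exp_excess_Suc exp_double power2_eq_square algebra_simps)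
  have integral: "has_bochner_integral M (\<lambda>\<omega>. (1 - \<kappa> * exp_excess \<gamma> (Suc t) \<omega>)\<^sup>2 * below \<gamma> t \<omega>)
      (expectation (Z 0) - 2 * \<kappa> * (expectation (Z 1) * expectation (\<lambda>\<omega>. exp (X (Suc t) \<omega>)))
        + \<kappa>\<^sup>2 * (expectation (Z 2) * expectation (\<lambda>\<omega>. exp (2 * X (Suc t) \<omega>))))"
    unfolding expand using int_Z
    by (intro has_bochner_integral_add has_bochner_integral_diff has_bochner_integral_mult_right
        first_moment second_moment has_bochner_integral_integrable)
  have "square_potential \<kappa> \<gamma> (Suc t)
      \<le> expectation (\<lambda>\<omega>. (1 - \<kappa> * exp_excess \<gamma> (Suc t) \<omega>)\<^sup>2 * below \<gamma> t \<omega>)"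
    unfolding square_potential_def
  proof (rule integral_mono')
    show "integrable M (\<lambda>\<omega>. (1 - \<kappa> * exp_excess \<gamma> (Suc t) \<omega>)\<^sup>2 * below \<gamma> t \<omega>)"
      by (rule integrable.intros[OF integral])
  qed (simp_all add: mult_left_mono below_Suc_le, simp add: below_def)
  also have "\<dots> \<le> expectation (Z 0) - 2 * \<kappa> * (expectation (Z 1) * (1 + \<nu>))
      + \<kappa>\<^sup>2 * (expectation (Z 2) * b)"
    unfolding has_bochner_integral_integral_eq[OF integral]
    using \<kappa> Z_nonneg one_plus_drift_le_expectation_exp[of "Suc t"] expectation_exp2_le[of "Suc t"]
    by (intro add_mono diff_mono mult_left_mono) auto
  finally show ?thesis by (simp add: Z_def[abs_def] occupation_def)
qed

lemma square_potential_decrease: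
  assumes \<kappa>: "\<kappa> = \<nu> / b"
  shows "square_potential \<kappa> \<gamma> (Suc t)
    \<le> square_potential \<kappa> \<gamma> t - \<kappa> * \<nu> * occupation \<gamma> t"
proof -
  define square_occupation
    where "square_occupation = expectation (\<lambda>\<omega>. (exp_excess \<gamma> t \<omega>)\<^sup>2 * below \<gamma> t \<omega>)"
  have \<kappa>_pos: "0 < \<kappa>" and \<kappa>_b: "\<kappa> * b = \<nu>"
    using one_plus_drift_le_exp2_bound drift_pos by (auto simp: \<kappa>)
  have "square_occupation \<le> occupation \<gamma> t"
    unfolding occupation_def square_occupation_def
    using integrable_exp_excess_power_below[of \<gamma> t 1] integrable_exp_excess_power_below[of \<gamma> t 2]
    by (intro integral_mono)
      (auto simp: below_def power2_eq_square exp_excess_nonneg exp_excess_le_1 intro!: mult_left_le)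
  then have "\<kappa> * \<nu> * square_occupation \<le> \<kappa> * \<nu> * occupation \<gamma> t"
    using \<kappa>_pos drift_pos by (intro mult_left_mono) auto
  moreover have "0 \<le> \<kappa>\<^sup>2 * square_occupation"
    unfolding square_occupation_def
    by (intro mult_nonneg_nonneg Bochner_Integration.integral_nonneg) (auto simp: below_def)
  moreover have "\<kappa>\<^sup>2 * (square_occupation * b) = \<kappa> * \<nu> * square_occupation"
    unfolding \<kappa>_b[symmetric] by (simp only: power2_eq_square mult_ac)
  moreover have "2 * \<kappa> * (occupation \<gamma> t * (1 + \<nu>))
      = 2 * \<kappa> * occupation \<gamma> t + 2 * (\<kappa> * \<nu> * occupation \<gamma> t)"
    by (simp add: algebra_simps)
  moreover have "square_potential \<kappa> \<gamma> (Suc t)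
      \<le> expectation (below \<gamma> t) - 2 * \<kappa> * (occupation \<gamma> t * (1 + \<nu>))
        + \<kappa>\<^sup>2 * (square_occupation * b)"
    unfolding square_occupation_def using \<kappa>_pos by (intro square_potential_Suc_le) simp
  moreover have "square_potential \<kappa> \<gamma> t
      = expectation (below \<gamma> t) - 2 * \<kappa> * occupation \<gamma> t + \<kappa>\<^sup>2 * square_occupation"
    unfolding square_occupation_def by (rule square_potential_eq)
  ultimately show ?thesis by linarith
qed

lemma sum_occupation_le:
  assumes \<gamma>: "\<gamma> \<ge> 0"
  shows "(\<Sum>t<n. occupation \<gamma> t) \<le> b / \<nu>\<^sup>2"
proof -
  define \<kappa> where "\<kappa> = \<nu> / b"
  have \<kappa>: "0 < \<kappa>" "\<kappa> \<le> 1"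
    using one_plus_drift_le_exp2_bound drift_pos by (auto simp: \<kappa>_def)
  have "square_potential \<kappa> \<gamma> n \<le> square_potential \<kappa> \<gamma> 0 - \<kappa> * \<nu> * (\<Sum>t<n. occupation \<gamma> t)"
  proof (induction n)
    case (Suc n)
    then show ?case
      using square_potential_decrease[OF \<kappa>_def, of \<gamma> n] by (simp add: algebra_simps)
  qed simp
  moreover have "0 \<le> square_potential \<kappa> \<gamma> n" by (rule square_potential_nonneg)
  moreover have "square_potential \<kappa> \<gamma> 0 \<le> 1"
  proof -
    have "square_potential \<kappa> \<gamma> 0 = (1 - \<kappa> * exp (- \<gamma>))\<^sup>2"
      using \<gamma> by (simp add: square_potential_def exp_excess_def below_def stays_below_def
          prob_space)
    moreover have "0 \<le> \<kappa> * exp (- \<gamma>)" "\<kappa> * exp (- \<gamma>) \<le> 1"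
      using \<kappa> \<gamma> by (auto intro: mult_le_one)
    ultimately show ?thesis by (simp add: power_le_one)
  qed
  ultimately have "\<kappa> * \<nu> * (\<Sum>t<n. occupation \<gamma> t) \<le> 1" by linarith
  then have "(\<Sum>t<n. occupation \<gamma> t) \<le> 1 / (\<kappa> * \<nu>)"
    using \<kappa> drift_pos by (simp add: pos_le_divide_eq mult.commute)
  then show ?thesis by (simp add: \<kappa>_def power2_eq_square)
qed

end

section \<open>Averages, deviations and the weight matrix\<close>

definition vmean :: "real^'n::finite \<Rightarrow> real" where
  "vmean v = (\<Sum>i\<in>UNIV. v $ i) / real CARD('n)"

definition deviation :: "real^'n::finite \<Rightarrow> real^'n" where
  "deviation v = (\<chi> i. v $ i - vmean v)"

lemma vmean_add: "vmean (u + v) = vmean u + vmean v"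
  by (simp add: vmean_def sum.distrib add_divide_distrib)

lemma vmean_axis: "vmean (axis i 1 :: real^'n::finite) = 1 / real CARD('n)"
  by (simp add: vmean_def axis_def)

lemma sum_eq_card_mult_vmean: "(\<Sum>i\<in>UNIV. v $ i) = real CARD('n) * vmean (v :: real^'n::finite)"
  by (simp add: vmean_def)

lemma vmean_deviation: "vmean (deviation v) = 0"
  unfolding vmean_def[of "deviation v"]
  by (simp add: deviation_def sum_subtractf sum_eq_card_mult_vmean)

lemma inner_deviation:
  "inner (deviation u) v = inner u v - real CARD('n) * vmean u * vmean (v :: real^'n::finite)"
  by (simp add: inner_vec_def deviation_def left_diff_distrib sum_subtractf sum_eq_card_mult_vmean
      flip: sum_distrib_left)

lemma norm_power2_eq_sum: "(norm (v :: real^'n::finite))\<^sup>2 = (\<Sum>i\<in>UNIV. (v $ i)\<^sup>2)"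
  unfolding power2_norm_eq_inner inner_vec_def by (simp add: power2_eq_square)

lemma norm_power2_decompose:
  "(norm (v :: real^'n::finite))\<^sup>2 = real CARD('n) * (vmean v)\<^sup>2 + (norm (deviation v))\<^sup>2"
  unfolding power2_norm_eq_inner inner_deviation inner_commute[of v "deviation v"]
  by (simp add: inner_deviation inner_commute vmean_deviation power2_eq_square)

lemma norm_deviation_le: "norm (deviation v) \<le> norm v"
  by (rule power2_le_imp_le) (simp_all add: norm_power2_decompose[of v])

definition mixing_rate :: "real^'n::finite^'n \<Rightarrow> real" where
  "mixing_rate W = onorm (\<lambda>x. (W - averaging_matrix) *v x)"

lemma mixing_rate_nonneg: "0 \<le> mixing_rate W"
  unfolding mixing_rate_def by (rule onorm_pos_le) simp

locale symmetric_stochastic =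
  fixes W :: "real^'n::finite^'n"
  assumes sym: "transpose W = W"
    and row_sum: "(\<Sum>j\<in>UNIV. W $ i $ j) = 1"
begin

lemma mult_ones: "W *v (\<chi> i. 1) = (\<chi> i. 1)"
  by (simp add: matrix_vector_mult_def row_sum vec_eq_iff)

lemma inner_mult_left: "inner v (W *v x) = inner (W *v v) x"
proof -
  have "W *v v = v v* W" using sym transpose_matrix_vector[of W v] by simp
  then show ?thesis by (simp add: dot_lmul_matrix)
qed

lemma vmean_mult: "vmean (W *v x) = vmean x"
proof -
  have vmean_inner: "vmean v = inner (\<chi> i. 1) v / real CARD('n)" for v :: "real^'n"
    by (simp add: vmean_def inner_vec_def)
  show ?thesis by (simp add: vmean_inner inner_mult_left mult_ones)
qed

lemma deviation_mult: "deviation (W *v x) = (W - averaging_matrix) *v deviation x"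
proof -
  have "W *v deviation x = deviation (W *v x)"
  proof -
    have dev: "deviation v = v - vmean v *s (\<chi> i. 1)" for v :: "real^'n"
      by (simp add: deviation_def vec_eq_iff)
    show ?thesis
      unfolding dev vmean_mult
      by (simp add: matrix_vector_mult_diff_distrib vector_scalar_commute mult_ones)
  qed
  moreover have "averaging_matrix *v deviation x = 0"
    using vmean_deviation[of x]
    by (simp add: matrix_vector_mult_def averaging_matrix_def vec_eq_iff vmean_def flip:
      sum_divide_distrib)
  ultimately show ?thesis by (simp add: matrix_vector_mult_diff_rdistrib)
qed

lemma norm_deviation_mult: "norm (deviation (W *v x)) \<le> mixing_rate W * norm (deviation x)"
  unfolding deviation_mult mixing_rate_def by (rule onorm) simp

lemma vmean_mult_funpow: "vmean (((*v) W ^^ n) v) = vmean v"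
  by (induction n) (simp_all add: vmean_mult)

lemma norm_deviation_mult_funpow:
  "norm (deviation (((*v) W ^^ n) v)) \<le> mixing_rate W ^ n * norm (deviation v)"
proof (induction n)
  case (Suc n)
  have "norm (deviation (((*v) W ^^ Suc n) v)) \<le> mixing_rate W * norm (deviation (((*v) W ^^ n) v))"
    using norm_deviation_mult by simp
  also have "\<dots> \<le> mixing_rate W * (mixing_rate W ^ n * norm (deviation v))"
    using Suc mixing_rate_nonneg by (rule mult_left_mono)
  finally show ?case by simp
qed simp

lemma norm_mult_funpow_le:
  assumes "mixing_rate W \<le> 1" "n \<ge> 1"
  shows "(norm (((*v) W ^^ n) v))\<^sup>2
    \<le> real CARD('n) * (vmean v)\<^sup>2 + (mixing_rate W)\<^sup>2 * (norm (deviation v))\<^sup>2"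
proof -
  have "norm (deviation (((*v) W ^^ n) v)) \<le> mixing_rate W ^ n * norm (deviation v)"
    by (rule norm_deviation_mult_funpow)
  also have "\<dots> \<le> mixing_rate W ^ 1 * norm (deviation v)"
    using assms mixing_rate_nonneg by (intro mult_right_mono power_decreasing) auto
  finally have "(norm (deviation (((*v) W ^^ n) v)))\<^sup>2 \<le> (mixing_rate W * norm (deviation v))\<^sup>2"
    by (intro power_mono) auto
  then show ?thesis
    unfolding norm_power2_decompose[of "((*v) W ^^ n) v"] vmean_mult_funpow
    by (simp add: power_mult_distrib)
qed

lemma inner_agent_stat:
  "inner v (agent_stat W \<eta> t \<omega>) = (\<Sum>j\<in>{1..t}. inner (((*v) W ^^ (t + 1 - j)) v) (\<eta> j \<omega>))"
proof (induction t arbitrary: v)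
  case (Suc t)
  have "inner v (agent_stat W \<eta> (Suc t) \<omega>)
      = (\<Sum>j\<in>{1..t}. inner (((*v) W ^^ (t + 1 - j)) (W *v v)) (\<eta> j \<omega>))
        + inner (W *v v) (\<eta> (Suc t) \<omega>)"
    by (simp add: inner_mult_left inner_add_right Suc.IH)
  also have "(\<Sum>j\<in>{1..t}. inner (((*v) W ^^ (t + 1 - j)) (W *v v)) (\<eta> j \<omega>))
      = (\<Sum>j\<in>{1..t}. inner (((*v) W ^^ (Suc t + 1 - j)) v) (\<eta> j \<omega>))"
    by (intro sum.cong refl) (simp add: Suc_diff_le funpow_swap1)
  finally show ?case by simp
qed simp

lemma vmean_agent_stat: "vmean (agent_stat W \<eta> t \<omega>) = (\<Sum>j\<in>{1..t}. vmean (\<eta> j \<omega>))"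
  by (induction t) (simp_all add: vmean_mult vmean_add, simp add: vmean_def)

lemma agent_stat_minus_vmean:
  "agent_stat W \<eta> t \<omega> $ i - vmean (agent_stat W \<eta> t \<omega>)
    = (\<Sum>j\<in>{1..t}. inner (deviation (((*v) W ^^ (t + 1 - j)) (axis i 1))) (\<eta> j \<omega>))"
proof -
  have "agent_stat W \<eta> t \<omega> $ i = inner (axis i 1) (agent_stat W \<eta> t \<omega>)" by (simp add: inner_axis')
  then show ?thesis
    unfolding inner_deviation vmean_mult_funpow vmean_axis sum_subtractf
    by (simp add: inner_agent_stat vmean_agent_stat)
qed

lemma sum_norm_deviation_rows_le:
  assumes "mixing_rate W < 1"
  shows "(\<Sum>j\<in>{1..t}. (norm (deviation (((*v) W ^^ (t + 1 - j)) (axis i 1))))\<^sup>2)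
    \<le> 1 / (1 - (mixing_rate W)\<^sup>2)"
proof -
  define r where "r = mixing_rate W"
  have r: "0 \<le> r" "r\<^sup>2 < 1"
    using assms mixing_rate_nonneg[of W] by (auto simp: r_def power_less_one_iff)
  have row: "(norm (deviation (((*v) W ^^ n) (axis i 1))))\<^sup>2 \<le> (r\<^sup>2) ^ n" for n
  proof -
    have "norm (deviation (((*v) W ^^ n) (axis i 1))) \<le> r ^ n * norm (deviation (axis i (1::real)))"
      unfolding r_def by (rule norm_deviation_mult_funpow)
    also have "\<dots> \<le> r ^ n * 1"
      using r norm_deviation_le[of "axis i (1::real)"] by (intro mult_left_mono) auto
    finally have "(norm (deviation (((*v) W ^^ n) (axis i 1))))\<^sup>2 \<le> (r ^ n)\<^sup>2"
      by (intro power_mono) auto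
    then show ?thesis by (simp add: mult.commute flip: power_mult)
  qed
  have "(\<Sum>j\<in>{1..t}. (norm (deviation (((*v) W ^^ (t + 1 - j)) (axis i 1))))\<^sup>2)
      \<le> (\<Sum>j\<in>{1..t}. (r\<^sup>2) ^ (t + 1 - j))"
    by (rule sum_mono) (rule row)
  also have "\<dots> = (\<Sum>n\<in>{1..t}. (r\<^sup>2) ^ n)"
    by (rule sum.reindex_bij_witness[of _ "\<lambda>n. t + 1 - n" "\<lambda>j. t + 1 - j"]) auto
  also have "\<dots> \<le> (\<Sum>n. (r\<^sup>2) ^ n)"
    using r by (intro sum_le_suminf summable_geometric) auto
  also have "\<dots> = 1 / (1 - r\<^sup>2)"
    using r by (intro suminf_geometric) simp
  finally show ?thesis by (simp add: r_def)
qed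

end

section \<open>Exit times\<close>

definition no_exit ::
    "'a measure \<Rightarrow> (nat \<Rightarrow> 'a \<Rightarrow> real^'n::finite) \<Rightarrow> 'n \<Rightarrow> real \<Rightarrow> real \<Rightarrow> nat \<Rightarrow> 'a set" where
  "no_exit M S i l h t = {\<omega> \<in> space M. \<forall>s\<in>{1..t}. S s \<omega> $ i \<in> {l..h}}"

lemma less_exit_time_iff: "enat t < exit_time S i l h \<omega> \<longleftrightarrow> (\<forall>s\<in>{1..t}. S s \<omega> $ i \<in> {l..h})"
proof -
  have "enat t < exit_time S i l h \<omega> \<longleftrightarrow> enat (Suc t) \<le> exit_time S i l h \<omega>"
    by (simp add: Suc_ile_eq)
  also have "\<dots> \<longleftrightarrow> (\<forall>s. 1 \<le> s \<and> S s \<omega> $ i \<notin> {l..h} \<longrightarrow> Suc t \<le> s)"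
    unfolding exit_time_def by (auto simp: le_Inf_iff)
  also have "\<dots> \<longleftrightarrow> (\<forall>s\<in>{1..t}. S s \<omega> $ i \<in> {l..h})"
    by (auto simp: not_less_eq_eq)
  finally show ?thesis .
qed

lemma exit_time_eq_INF:
  "exit_time S i l h \<omega> = (INF t\<in>{1..}. if S t \<omega> $ i \<in> {l..h} then \<infinity> else enat t)"
  unfolding exit_time_def by (intro antisym INF_greatest Inf_greatest)
    (auto intro: Inf_lower INF_lower2)

lemma measurable_exit_time:
  assumes "\<And>t. t \<ge> 1 \<Longrightarrow> (\<lambda>\<omega>. S t \<omega> $ i) \<in> borel_measurable M"
  shows "exit_time S i l h \<in> measurable M (count_space UNIV)"
proof -
  have "(\<lambda>\<omega>. if S t \<omega> $ i \<in> {l..h} then \<infinity> else enat t) \<in> measurable M (count_space UNIV)"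
    if t: "t \<in> {1..}" for t
  proof -
    have [measurable]: "(\<lambda>\<omega>. S t \<omega> $ i) \<in> borel_measurable M" using assms t by simp
    show ?thesis by measurable
  qed
  then show ?thesis
    unfolding exit_time_eq_INF[abs_def] by (intro measurable_INF) auto
qed

lemma (in prob_space) expected_time_exit_time:
  assumes S: "\<And>t. t \<ge> 1 \<Longrightarrow> (\<lambda>\<omega>. S t \<omega> $ i) \<in> borel_measurable M"
    and summable: "summable (\<lambda>t. prob (no_exit M S i l h t))"
  shows "expected_time M (exit_time S i l h) = ereal (\<Sum>t. prob (no_exit M S i l h t))"
proof -
  have "(\<integral>\<^sup>+\<omega>. ennreal_of_enat (exit_time S i l h \<omega>) \<partial>M)
      = (\<Sum>t. ennreal (prob (no_exit M S i l h t)))"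
    using measurable_exit_time[OF S]
    by (simp add: nn_integral_enat_function less_exit_time_iff emeasure_eq_measure no_exit_def)
  also have "\<dots> = ennreal (\<Sum>t. prob (no_exit M S i l h t))"
    using summable by (intro suminf_ennreal2) auto
  finally show ?thesis
    using summable by (simp add: expected_time_def suminf_nonneg)
qed

text \<open>
  Here \<open>x\<close> is the statistic of the agent and \<open>s\<close> the network average. After an exit above, the
  deviation \<open>x - s\<close> exceeds \<open>\<gamma> - s\<close>; after an exit below, \<open>- (x + s)\<close> does.
\<close>

lemma overshoot_le:
  fixes s x \<gamma> \<theta> :: real
  assumes "\<theta> > 0" "s \<le> \<gamma>" "x \<notin> {-\<gamma>..\<gamma>}"
  shows "\<gamma> - s \<le> exp (2 * (x - s)) * exp (s - \<gamma>) + exp (- \<theta> * (x + s)) / \<theta>"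
proof -
  consider (above) "x > \<gamma>" | (below) "x < - \<gamma>" using assms(3) by force
  then show ?thesis
  proof cases
    case above
    then have "\<gamma> - s \<le> 1 + (2 * (x - s) + (s - \<gamma>))" using assms(2) by simp
    also have "\<dots> \<le> exp (2 * (x - s) + (s - \<gamma>))" by (rule exp_ge_add_one_self)
    also have "\<dots> = exp (2 * (x - s)) * exp (s - \<gamma>)" by (rule exp_add)
    finally show ?thesis using assms(1) by (simp add: add_increasing2)
  next
    case below
    then have "\<theta> * (\<gamma> - s) \<le> \<theta> * - (x + s)" using assms(1) by (intro mult_left_mono) auto
    also have "\<dots> = - \<theta> * (x + s)" by (simp add: algebra_simps)
    also have "\<dots> \<le> exp (- \<theta> * (x + s))" using exp_ge_add_one_self[of "- \<theta> * (x + s)"] by linarith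
    finally have "\<gamma> - s \<le> exp (- \<theta> * (x + s)) / \<theta>"
      using assms(1) by (simp add: pos_le_divide_eq mult.commute)
    then show ?thesis by (simp add: add_increasing)
  qed
qed

section \<open>The statistics under Gaussian log-likelihood ratios\<close>

text \<open>
  By the orthogonal splitting into average and deviation, \<open>row_energy W\<close> bounds the squared norm of
  every row of a positive power of \<open>W\<close>; in the notation of the theorem it is \<open>(k + 1) / N\<close>.
\<close>

definition row_energy :: "real^'n::finite^'n \<Rightarrow> real" where
  "row_energy W = 1 / real CARD('n) + (mixing_rate W)\<^sup>2"

definition decay_rate :: "real \<Rightarrow> real \<Rightarrow> real^'n::finite^'n \<Rightarrow> real" where
  "decay_rate \<nu> \<sigma> W = \<nu>\<^sup>2 / (2 * \<sigma>\<^sup>2 * row_energy W)"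

definition contrast_moment :: "real \<Rightarrow> real^'n::finite^'n \<Rightarrow> real" where
  "contrast_moment \<sigma> W = exp (2 * \<sigma>\<^sup>2 / (1 - (mixing_rate W)\<^sup>2))"

definition exit_deficit :: "real \<Rightarrow> real \<Rightarrow> real^'n::finite^'n \<Rightarrow> real" where
  "exit_deficit \<nu> \<sigma> W =
    contrast_moment \<sigma> W * (exp (2 * \<nu> + 2 * \<sigma>\<^sup>2 / real CARD('n)) / \<nu>\<^sup>2)
    + \<nu> / decay_rate \<nu> \<sigma> W * (1 / (1 - exp (- decay_rate \<nu> \<sigma> W)))"

lemma row_energy_pos: "0 < row_energy W"
  by (simp add: row_energy_def add_pos_nonneg)

lemma borel_measurable_vecI:
  fixes f :: "'a \<Rightarrow> real^'n::finite"
  assumes "\<And>i. (\<lambda>x. f x $ i) \<in> borel_measurable M"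
  shows "f \<in> borel_measurable M"
  using assms by (subst borel_measurable_euclidean_space) (auto simp: Basis_vec_def inner_axis)

lemma borel_measurable_vmean [measurable]: "vmean \<in> borel_measurable borel"
  unfolding vmean_def[abs_def] by measurable

lemma borel_measurable_matrix_vector_mult [measurable]:
  "(*v) (A :: real^'n^'m::finite) \<in> borel_measurable borel"
  by (intro borel_measurable_continuous_onI linear_continuous_on matrix_vector_mul_bounded_linear)

lemma sum_inner_eq_sum_components:
  fixes a x :: "nat \<Rightarrow> real^'n::finite"
  shows "(\<Sum>j\<in>J. inner (a j) (x j)) = (\<Sum>(i, j)\<in>UNIV \<times> J. a j $ i * x j $ i)"
  unfolding inner_vec_def by (subst sum.swap) (simp add: sum.cartesian_product)

lemma sum_norm_eq_sum_components:
  fixes a :: "nat \<Rightarrow> real^'n::finite"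
  shows "(\<Sum>j\<in>J. (norm (a j))\<^sup>2) = (\<Sum>(i, j)\<in>UNIV \<times> J. (a j $ i)\<^sup>2)"
  unfolding norm_power2_eq_sum by (subst sum.swap) (simp add: sum.cartesian_product)

lemma sum_vmean_eq_sum_components:
  fixes a :: "nat \<Rightarrow> real^'n::finite"
  shows "real CARD('n) * (\<Sum>j\<in>J. vmean (a j)) = (\<Sum>(i, j)\<in>UNIV \<times> J. a j $ i)"
  unfolding sum_distrib_left sum_eq_card_mult_vmean[symmetric]
  by (subst sum.swap) (simp add: sum.cartesian_product)

lemma agent_stat_cong:
  "(\<And>j. j \<in> {1..t} \<Longrightarrow> \<eta> j \<omega> = \<eta>' j \<omega>') \<Longrightarrow> agent_stat W \<eta> t \<omega> = agent_stat W \<eta>' t \<omega>'"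
  by (induction t) simp_all

lemma measurable_agent_stat:
  assumes "\<And>j. j \<in> {1..t} \<Longrightarrow> \<eta> j \<in> borel_measurable M"
  shows "agent_stat W \<eta> t \<in> borel_measurable M"
  using assms
proof (induction t)
  case 0
  have "agent_stat W \<eta> 0 = (\<lambda>_. 0)" by auto
  then show ?case by simp
next
  case (Suc t)
  have [measurable]: "\<eta> (Suc t) \<in> borel_measurable M" "agent_stat W \<eta> t \<in> borel_measurable M"
    using Suc by auto
  have "agent_stat W \<eta> (Suc t) = (\<lambda>\<omega>. W *v (agent_stat W \<eta> t \<omega> + \<eta> (Suc t) \<omega>))" by auto
  also have "\<dots> \<in> borel_measurable M" by measurable
  finally show ?case .
qed

locale gaussian_consensus = prob_space M + symmetric_stochastic W
  for M :: "'a measure" and W :: "real^'n::finite^'n" +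
  fixes \<eta> :: "nat \<Rightarrow> 'a \<Rightarrow> real^'n" and \<nu> \<sigma> :: real
  assumes mean_pos: "\<nu> > 0" and sd_pos: "\<sigma> > 0"
    and indep_components: "indep_vars (\<lambda>_. borel) (\<lambda>(i, t) \<omega>. \<eta> t \<omega> $ i) (UNIV \<times> {1..})"
    and normal_component: "t \<ge> 1 \<Longrightarrow> distributed M lborel (\<lambda>\<omega>. \<eta> t \<omega> $ i) (normal_density \<nu> \<sigma>)"
    and mixing: "mixing_rate W < 1"
begin

abbreviation "S \<equiv> agent_stat W \<eta>"
abbreviation "q \<equiv> decay_rate \<nu> \<sigma> W"

lemma decay_rate_pos: "0 < q"
  using mean_pos sd_pos row_energy_pos[of W] by (simp add: decay_rate_def)

lemma measurable_eta [measurable]: "t \<ge> 1 \<Longrightarrow> \<eta> t \<in> borel_measurable M"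
  by (rule borel_measurable_vecI) (use distributed_measurable[OF normal_component] in simp)

lemma measurable_S [measurable]: "S t \<in> borel_measurable M"
  by (rule measurable_agent_stat) auto

lemma measurable_S_nth [measurable]: "(\<lambda>\<omega>. S t \<omega> $ i) \<in> borel_measurable M"
  by (rule measurable_compose[OF measurable_S borel_measurable_nth])

lemma indep_eta: "indep_vars (\<lambda>_. borel) \<eta> {1..}"
proof -
  have "indep_vars (\<lambda>t. PiM (UNIV \<times> {t}) (\<lambda>_. borel))
      (\<lambda>t \<omega>. \<lambda>p\<in>UNIV \<times> {t}. (case p of (i, t) \<Rightarrow> \<lambda>\<omega>. \<eta> t \<omega> $ i) \<omega>) {1..}"
    by (rule indep_vars_restrict[OF indep_components]) (auto simp: disjoint_family_on_def)
  then have "indep_vars (\<lambda>_. borel)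
      (\<lambda>t \<omega>. (\<lambda>x. \<chi> i. x (i, t)) (\<lambda>p\<in>UNIV \<times> {t}. (case p of (i, t) \<Rightarrow> \<lambda>\<omega>. \<eta> t \<omega> $ i) \<omega>)) {1..}"
    by (rule indep_vars_compose2) (rule borel_measurable_vecI, simp)
  then show ?thesis by (simp add: vec_nth_inverse)
qed

lemma normal_sum_inner:
  assumes J: "finite J" "J \<subseteq> {1..}" and a: "\<exists>j\<in>J. a j \<noteq> 0"
  shows "distributed M lborel (\<lambda>\<omega>. \<Sum>j\<in>J. inner (a j) (\<eta> j \<omega>))
    (normal_density (real CARD('n) * (\<Sum>j\<in>J. vmean (a j)) * \<nu>) (\<sigma> * sqrt (\<Sum>j\<in>J. (norm (a j))\<^sup>2)))"
proof -
  let ?X = "\<lambda>(i, j) \<omega>. \<eta> j \<omega> $ i" and ?c = "\<lambda>(i, j). a j $ i"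
  have "distributed M lborel (\<lambda>\<omega>. \<Sum>p\<in>UNIV \<times> J. ?c p * ?X p \<omega>)
      (normal_density (\<Sum>p\<in>UNIV \<times> J. ?c p * \<nu>) (sqrt (\<Sum>p\<in>UNIV \<times> J. (?c p)\<^sup>2 * \<sigma>\<^sup>2)))"
  proof (rule normal_linear_combination)
    show "indep_vars (\<lambda>_. borel) ?X (UNIV \<times> J)"
      by (rule indep_vars_subset[OF indep_components]) (use J in auto)
    show "\<exists>p\<in>UNIV \<times> J. ?c p \<noteq> 0" using a by (fastforce simp: vec_eq_iff)
  qed (use J sd_pos normal_component in auto)
  moreover have "(\<lambda>\<omega>. \<Sum>p\<in>UNIV \<times> J. ?c p * ?X p \<omega>) = (\<lambda>\<omega>. \<Sum>j\<in>J. inner (a j) (\<eta> j \<omega>))"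
    unfolding sum_inner_eq_sum_components by (simp add: case_prod_unfold)
  moreover have "(\<Sum>p\<in>UNIV \<times> J. ?c p * \<nu>) = real CARD('n) * (\<Sum>j\<in>J. vmean (a j)) * \<nu>"
    unfolding sum_vmean_eq_sum_components by (simp add: sum_distrib_right)
  moreover have "sqrt (\<Sum>p\<in>UNIV \<times> J. (?c p)\<^sup>2 * \<sigma>\<^sup>2) = \<sigma> * sqrt (\<Sum>j\<in>J. (norm (a j))\<^sup>2)"
    using sd_pos unfolding sum_norm_eq_sum_components
    by (simp add: case_prod_unfold real_sqrt_mult mult.commute[of \<sigma>] flip: sum_distrib_right)
  ultimately show ?thesis by simp
qed

lemma normal_inner_S:
  assumes t: "t \<ge> 1" and v: "vmean v \<noteq> 0"
  obtains s where "s > 0"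
    "s\<^sup>2 \<le> \<sigma>\<^sup>2 * real t
      * (real CARD('n) * (vmean v)\<^sup>2 + (mixing_rate W)\<^sup>2 * (norm (deviation v))\<^sup>2)"
    "distributed M lborel (\<lambda>\<omega>. inner v (S t \<omega>))
      (normal_density (real CARD('n) * vmean v * \<nu> * real t) s)"
proof -
  define w where "w j = ((*v) W ^^ (t + 1 - j)) v" for j
  define energy where "energy = (\<Sum>j\<in>{1..t}. (norm (w j))\<^sup>2)"
  have vmean_w: "vmean (w j) = vmean v" for j
    unfolding w_def by (rule vmean_mult_funpow)
  have w_nz: "w j \<noteq> 0" for j
    using vmean_w[of j] v by (auto simp: vmean_def)
  have "0 < energy"
    unfolding energy_def using t w_nz by (intro sum_pos) auto
  have "distributed M lborel (\<lambda>\<omega>. \<Sum>j\<in>{1..t}. inner (w j) (\<eta> j \<omega>))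
      (normal_density (real CARD('n) * (\<Sum>j\<in>{1..t}. vmean (w j)) * \<nu>) (\<sigma> * sqrt energy))"
    unfolding energy_def using t w_nz by (intro normal_sum_inner) auto
  then have distr: "distributed M lborel (\<lambda>\<omega>. inner v (S t \<omega>))
      (normal_density (real CARD('n) * vmean v * \<nu> * real t) (\<sigma> * sqrt energy))"
    unfolding w_def[symmetric] vmean_w inner_agent_stat by (simp add: mult_ac)
  have "energy \<le> real (card {1..t})
      * (real CARD('n) * (vmean v)\<^sup>2 + (mixing_rate W)\<^sup>2 * (norm (deviation v))\<^sup>2)"
    unfolding energy_def w_def using mixing by (intro sum_bounded_above norm_mult_funpow_le) auto
  then have "\<sigma>\<^sup>2 * energy \<le> \<sigma>\<^sup>2 * real t
      * (real CARD('n) * (vmean v)\<^sup>2 + (mixing_rate W)\<^sup>2 * (norm (deviation v))\<^sup>2)"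
    unfolding mult.assoc by (intro mult_left_mono) simp_all
  then show thesis
    using that[OF _ _ distr] sd_pos \<open>0 < energy\<close> by (simp add: power_mult_distrib)
qed

lemma norm_deviation_axis_le: "(norm (deviation (axis i 1 :: real^'n)))\<^sup>2 \<le> 1"
  using norm_deviation_le[of "axis i (1::real)"] by (simp add: power_le_one)

lemma normal_S:
  assumes t: "t \<ge> 1"
  obtains s where "s > 0" "s\<^sup>2 \<le> \<sigma>\<^sup>2 * real t * row_energy W"
    "distributed M lborel (\<lambda>\<omega>. S t \<omega> $ i) (normal_density (\<nu> * real t) s)"
proof -
  obtain s where s: "s > 0"
    "s\<^sup>2 \<le> \<sigma>\<^sup>2 * real t
      * (1 / real CARD('n) + (mixing_rate W)\<^sup>2 * (norm (deviation (axis i 1 :: real^'n)))\<^sup>2)"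
    "distributed M lborel (\<lambda>\<omega>. S t \<omega> $ i) (normal_density (\<nu> * real t) s)"
    using normal_inner_S[OF t, of "axis i 1"]
    by (auto simp: vmean_axis inner_axis' power2_eq_square)
  have "s\<^sup>2 \<le> \<sigma>\<^sup>2 * real t * row_energy W"
    unfolding row_energy_def
    by (rule order_trans[OF s(2)])
      (intro mult_left_mono add_left_mono mult_left_le norm_deviation_axis_le, auto)
  then show thesis using s that by blast
qed

subsection \<open>The upper bound\<close>

lemma prob_no_exit_le:
  assumes \<gamma>: "\<gamma> > 0" and t: "\<gamma> / \<nu> \<le> real t"
  shows "prob (no_exit M S i l \<gamma> t) \<le> 1/2 * exp (- (q * (real t - \<gamma> / \<nu>)\<^sup>2 / real t))"
proof -
  have "\<gamma> / \<nu> > 0" using \<gamma> mean_pos by simp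
  then have t_ge: "t \<ge> 1" using t by linarith
  have \<gamma>_le: "\<gamma> \<le> \<nu> * real t" using t mean_pos by (simp add: field_simps)
  obtain s where s: "s > 0" "s\<^sup>2 \<le> \<sigma>\<^sup>2 * real t * row_energy W"
    and distr: "distributed M lborel (\<lambda>\<omega>. S t \<omega> $ i) (normal_density (\<nu> * real t) s)"
    by (rule normal_S[OF t_ge])
  have "prob (no_exit M S i l \<gamma> t) \<le> prob {\<omega> \<in> space M. S t \<omega> $ i \<le> \<gamma>}"
    using t_ge unfolding no_exit_def by (intro finite_measure_mono) auto
  also have "\<dots> \<le> 1/2 * exp (- ((\<nu> * real t - \<gamma>)\<^sup>2 / (2 * s\<^sup>2)))"
    by (rule normal_lower_tail[OF distr s(1) \<gamma>_le])
  also have "\<dots> \<le> 1/2 * exp (- (q * (real t - \<gamma> / \<nu>)\<^sup>2 / real t))"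
  proof -
    have "real t - \<gamma> / \<nu> = (\<nu> * real t - \<gamma>) / \<nu>" using mean_pos by (simp add: field_simps)
    then have "q * (real t - \<gamma> / \<nu>)\<^sup>2 / real t
        = (\<nu> * real t - \<gamma>)\<^sup>2 / (2 * (\<sigma>\<^sup>2 * real t * row_energy W))"
      using mean_pos by (simp add: decay_rate_def power_divide mult_ac)
    also have "\<dots> \<le> (\<nu> * real t - \<gamma>)\<^sup>2 / (2 * s\<^sup>2)"
      using s sd_pos row_energy_pos[of W] t_ge by (intro divide_left_mono mult_pos_pos) auto
    finally show ?thesis by simp
  qed
  finally show ?thesis .
qed

lemma threshold_pos:
  assumes "2/7 * ln 4 \<le> q * (\<gamma> / \<nu>)"
  shows "\<gamma> > 0"
proof -
  have "0 < q * (\<gamma> / \<nu>)" using assms by (rule less_le_trans[rotated]) simp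
  then show ?thesis
    using decay_rate_pos mean_pos by (simp add: zero_less_mult_iff zero_less_divide_iff)
qed

lemma
  assumes \<gamma>: "2/7 * ln 4 \<le> q * (\<gamma> / \<nu>)"
  shows summable_prob_no_exit: "summable (\<lambda>t. prob (no_exit M S i l \<gamma> t))"
    and suminf_prob_no_exit_le:
      "(\<Sum>t. prob (no_exit M S i l \<gamma> t)) \<le> 5/4 * (\<gamma> / \<nu>) + 1 / (1 - exp (- q))"
proof -
  note series = suminf_gaussian_tail_le[OF decay_rate_pos \<gamma>, of "\<lambda>t. prob (no_exit M S i l \<gamma> t)"]
  show "summable (\<lambda>t. prob (no_exit M S i l \<gamma> t))"
    and "(\<Sum>t. prob (no_exit M S i l \<gamma> t)) \<le> 5/4 * (\<gamma> / \<nu>) + 1 / (1 - exp (- q))"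
    by (rule series; use prob_no_exit_le[OF threshold_pos[OF \<gamma>]] in simp)+
qed

subsection \<open>The lower bound\<close>

lemma normal_S_plus_vmean:
  assumes t: "t \<ge> 1"
  obtains s where "s > 0" "s\<^sup>2 \<le> 4 * (\<sigma>\<^sup>2 * real t * row_energy W)"
    "distributed M lborel (\<lambda>\<omega>. S t \<omega> $ i + vmean (S t \<omega>)) (normal_density (2 * \<nu> * real t) s)"
proof -
  define v :: "real^'n" where "v = axis i 1 + (\<chi> _. 1 / real CARD('n))"
  have vmean_v: "vmean v = 2 / real CARD('n)"
    by (simp add: v_def vmean_add vmean_axis) (simp add: vmean_def)
  have inner_v: "inner v x = x $ i + vmean x" for x
    by (simp add: v_def inner_add_left inner_axis')
      (simp add: inner_vec_def vmean_def sum_divide_distrib)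
  have "deviation v = deviation (axis i 1)"
    unfolding deviation_def vmean_v vmean_axis by (simp add: v_def vec_eq_iff add_divide_distrib)
  then have deviation_v: "(norm (deviation v))\<^sup>2 \<le> 1"
    using norm_deviation_axis_le by simp
  obtain s where s: "s > 0"
    "s\<^sup>2 \<le> \<sigma>\<^sup>2 * real t
      * (real CARD('n) * (vmean v)\<^sup>2 + (mixing_rate W)\<^sup>2 * (norm (deviation v))\<^sup>2)"
    "distributed M lborel (\<lambda>\<omega>. inner v (S t \<omega>))
      (normal_density (real CARD('n) * vmean v * \<nu> * real t) s)"
    by (rule normal_inner_S[OF t, of v]) (use vmean_v in auto)
  have "(mixing_rate W)\<^sup>2 * (norm (deviation v))\<^sup>2 \<le> (mixing_rate W)\<^sup>2"
    using deviation_v by (intro mult_left_le) auto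
  also have "\<dots> \<le> 4 * (mixing_rate W)\<^sup>2" by simp
  finally have "real CARD('n) * (vmean v)\<^sup>2 + (mixing_rate W)\<^sup>2 * (norm (deviation v))\<^sup>2
      \<le> 4 * row_energy W"
    by (simp add: vmean_v row_energy_def power_divide power2_eq_square[of "real CARD('n)"])
  then have "\<sigma>\<^sup>2 * real t
      * (real CARD('n) * (vmean v)\<^sup>2 + (mixing_rate W)\<^sup>2 * (norm (deviation v))\<^sup>2)
      \<le> \<sigma>\<^sup>2 * real t * (4 * row_energy W)"
    by (rule mult_left_mono) simp
  then have "s\<^sup>2 \<le> 4 * (\<sigma>\<^sup>2 * real t * row_energy W)"
    using s(2) by simp
  moreover have "distributed M lborel (\<lambda>\<omega>. S t \<omega> $ i + vmean (S t \<omega>))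
      (normal_density (2 * \<nu> * real t) s)"
    using s(3) unfolding inner_v by (simp add: vmean_v)
  ultimately show thesis using s(1) that by blast
qed

definition lower_excess :: "'n \<Rightarrow> nat \<Rightarrow> 'a \<Rightarrow> real" where
  "lower_excess i t \<omega> = exp (- (q / \<nu>) * (S t \<omega> $ i + vmean (S t \<omega>)))"

lemma
  shows integrable_lower_excess: "integrable M (lower_excess i t)"
    and expectation_lower_excess_le: "expectation (lower_excess i t) \<le> exp (- q) ^ t"
proof -
  have "\<exists>I\<le>exp (- (q * real t)). has_bochner_integral M (lower_excess i t) I"
  proof (cases "t = 0")
    case True
    then have "has_bochner_integral M (lower_excess i t) 1"
      by (simp add: lower_excess_def[abs_def] has_bochner_integral_iff prob_space vmean_def)
    then show ?thesis using True by auto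
  next
    case False
    then obtain s where s: "s > 0" "s\<^sup>2 \<le> 4 * (\<sigma>\<^sup>2 * real t * row_energy W)"
      "distributed M lborel (\<lambda>\<omega>. S t \<omega> $ i + vmean (S t \<omega>)) (normal_density (2 * \<nu> * real t) s)"
      using normal_S_plus_vmean[of t i] by auto
    define I where "I = exp (- (q / \<nu>) * (2 * \<nu> * real t) + (- (q / \<nu>))\<^sup>2 * s\<^sup>2 / 2)"
    have "has_bochner_integral M (lower_excess i t) I"
      unfolding I_def lower_excess_def by (rule normal_exponential_moment[OF s(3,1)])
    moreover have "I \<le> exp (- (q * real t))"
    proof -
      have "(q / \<nu>)\<^sup>2 * s\<^sup>2 \<le> (q / \<nu>)\<^sup>2 * (4 * (\<sigma>\<^sup>2 * real t * row_energy W))"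
        using s(2) by (intro mult_left_mono) auto
      also have "\<dots> = 2 * (q * real t) * (q * (2 * \<sigma>\<^sup>2 * row_energy W) / \<nu>\<^sup>2)"
        by (simp add: power2_eq_square)
      also have "q * (2 * \<sigma>\<^sup>2 * row_energy W) / \<nu>\<^sup>2 = 1"
        using mean_pos sd_pos row_energy_pos[of W] by (simp add: decay_rate_def)
      finally have "(q / \<nu>)\<^sup>2 * s\<^sup>2 / 2 \<le> q * real t" by simp
      moreover have "I = exp (- 2 * (q * real t) + (q / \<nu>)\<^sup>2 * s\<^sup>2 / 2)"
        using mean_pos by (simp add: I_def)
      ultimately show ?thesis by (simp only: exp_le_cancel_iff)
    qed
    ultimately show ?thesis by blast
  qed
  moreover have "exp (- (q * real t)) = exp (- q) ^ t"
    by (simp add: mult.commute flip: exp_of_nat_mult)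
  ultimately show "integrable M (lower_excess i t)" "expectation (lower_excess i t) \<le> exp (- q) ^ t"
    by (auto simp: has_bochner_integral_iff)
qed

lemma
  assumes t: "t \<ge> 1"
  shows has_bochner_integral_vmean_eta: "has_bochner_integral M (\<lambda>\<omega>. vmean (\<eta> t \<omega>)) \<nu>"
    and has_bochner_integral_exp_vmean_eta: "has_bochner_integral M (\<lambda>\<omega>. exp (c * vmean (\<eta> t \<omega>)))
      (exp (c * \<nu> + c\<^sup>2 * (\<sigma>\<^sup>2 / real CARD('n)) / 2))"
proof -
  define a :: "real^'n" where "a = (\<chi> _. 1 / real CARD('n))"
  define s where "s = \<sigma> * norm a"
  have inner_a: "inner a x = vmean x" for x
    by (simp add: a_def inner_vec_def vmean_def sum_divide_distrib)
  have vmean_a: "real CARD('n) * vmean a = 1"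
    by (simp add: a_def vmean_def)
  have norm_a: "(norm a)\<^sup>2 = 1 / real CARD('n)"
    unfolding norm_power2_eq_sum by (simp add: a_def power2_eq_square)
  have "a \<noteq> 0" using vmean_a by (auto simp: vmean_def)
  then have s: "s > 0" "s\<^sup>2 = \<sigma>\<^sup>2 / real CARD('n)"
    using sd_pos by (auto simp: s_def power_mult_distrib norm_a)
  have distr: "distributed M lborel (\<lambda>\<omega>. vmean (\<eta> t \<omega>)) (normal_density \<nu> s)"
    using normal_sum_inner[of "{t}" "\<lambda>_. a"] t \<open>a \<noteq> 0\<close> by (simp add: inner_a vmean_a s_def)
  have "integrable M (\<lambda>\<omega>. vmean (\<eta> t \<omega>))"
    by (rule distributed_integrable_var[OF distr])
      (use integrable_normal_moment_nz_1[OF s(1)] in auto)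
  moreover have "expectation (\<lambda>\<omega>. vmean (\<eta> t \<omega>)) = \<nu>"
    using distributed_integral[OF distr, of "\<lambda>x. x"] integral_normal_moment_nz_1[OF s(1)] by simp
  ultimately show "has_bochner_integral M (\<lambda>\<omega>. vmean (\<eta> t \<omega>)) \<nu>"
    by (simp add: has_bochner_integral_iff)
  show "has_bochner_integral M (\<lambda>\<omega>. exp (c * vmean (\<eta> t \<omega>)))
      (exp (c * \<nu> + c\<^sup>2 * (\<sigma>\<^sup>2 / real CARD('n)) / 2))"
    using normal_exponential_moment[OF distr s(1), of c] by (simp only: s(2))
qed

sublocale walk: positive_drift_walk M "\<lambda>t \<omega>. vmean (\<eta> t \<omega>)" \<nu>
  "exp (2 * \<nu> + 2 * \<sigma>\<^sup>2 / real CARD('n))"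
proof
  show "indep_vars (\<lambda>_. borel) (\<lambda>t \<omega>. vmean (\<eta> t \<omega>)) {1..}"
    by (rule indep_vars_compose2[OF indep_eta]) simp
  show "integrable M (\<lambda>\<omega>. exp (2 * vmean (\<eta> t \<omega>)))"
    "expectation (\<lambda>\<omega>. exp (2 * vmean (\<eta> t \<omega>))) \<le> exp (2 * \<nu> + 2 * \<sigma>\<^sup>2 / real CARD('n))"
    if "t \<ge> 1" for t
    using has_bochner_integral_exp_vmean_eta[OF that, of 2]
    by (simp_all add: has_bochner_integral_iff)
qed (use mean_pos has_bochner_integral_vmean_eta in auto)

text \<open>
  A tilt by a contrast, a linear form with vanishing coefficient sum in each round, leaves the law
  of the averages unchanged. This replaces the independence of averages and deviations.
\<close>

lemma nn_integral_exp_contrast: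
  assumes contrast: "\<And>j. j \<in> {1..t} \<Longrightarrow> vmean (d j) = 0"
    and f [measurable]: "f \<in> borel_measurable (PiM {1..t} (\<lambda>_. borel))"
  shows "(\<integral>\<^sup>+\<omega>. ennreal (exp (\<Sum>j\<in>{1..t}. inner (d j) (\<eta> j \<omega>))) * f (\<lambda>j\<in>{1..t}. vmean (\<eta> j \<omega>)) \<partial>M)
    = ennreal (exp (\<sigma>\<^sup>2 / 2 * (\<Sum>j\<in>{1..t}. (norm (d j))\<^sup>2)))
      * (\<integral>\<^sup>+\<omega>. f (\<lambda>j\<in>{1..t}. vmean (\<eta> j \<omega>)) \<partial>M)"
proof -
  let ?I = "(UNIV :: 'n set) \<times> {1..t}"
  let ?X = "\<lambda>(i, j) \<omega>. \<eta> j \<omega> $ i" and ?c = "\<lambda>(i, j). d j $ i"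
  define G where "G x = f (\<lambda>j\<in>{1..t}. (\<Sum>i\<in>UNIV. x (i, j)) / real CARD('n))"
    for x :: "'n \<times> nat \<Rightarrow> real"
  have G_meas: "G \<in> borel_measurable (PiM ?I (\<lambda>_. borel))"
    unfolding G_def by measurable
  have G: "G (\<lambda>p\<in>?I. ?X p \<omega>) = f (\<lambda>j\<in>{1..t}. vmean (\<eta> j \<omega>))" for \<omega>
    by (simp add: G_def vmean_def cong: restrict_cong)
  have G_shift: "G (\<lambda>p\<in>?I. ?X p \<omega> + ?c p * \<sigma>\<^sup>2) = f (\<lambda>j\<in>{1..t}. vmean (\<eta> j \<omega>))" for \<omega>
  proof -
    have "(\<Sum>i\<in>UNIV. d j $ i) = 0" if "j \<in> {1..t}" for j
      using contrast[OF that] by (simp add: vmean_def)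
    then show ?thesis
      by (simp add: G_def vmean_def sum.distrib flip: sum_distrib_right cong: restrict_cong)
  qed
  have log_mgf: "(\<Sum>p\<in>?I. ?c p * \<nu> + (?c p)\<^sup>2 * \<sigma>\<^sup>2 / 2) = \<sigma>\<^sup>2 / 2 * (\<Sum>j\<in>{1..t}. (norm (d j))\<^sup>2)"
  proof -
    have "(\<Sum>p\<in>?I. ?c p) = 0"
      using contrast sum_vmean_eq_sum_components[of d "{1..t}"] by simp
    then have "(\<Sum>p\<in>?I. ?c p * \<nu>) = 0" by (simp flip: sum_distrib_right)
    then show ?thesis
      unfolding sum_norm_eq_sum_components
      by (simp add: sum.distrib case_prod_unfold sum_distrib_left mult.commute)
  qed
  have "(\<integral>\<^sup>+\<omega>. ennreal (exp (\<Sum>p\<in>?I. ?c p * ?X p \<omega>)) * G (\<lambda>p\<in>?I. ?X p \<omega>) \<partial>M)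
      = ennreal (exp (\<Sum>p\<in>?I. ?c p * \<nu> + (?c p)\<^sup>2 * \<sigma>\<^sup>2 / 2))
        * (\<integral>\<^sup>+\<omega>. G (\<lambda>p\<in>?I. ?X p \<omega> + ?c p * \<sigma>\<^sup>2) \<partial>M)"
  proof (rule nn_integral_indep_normal_exp_tilt)
    show "indep_vars (\<lambda>_. borel) ?X ?I"
      by (rule indep_vars_subset[OF indep_components]) auto
  qed (use sd_pos normal_component G_meas in auto)
  then show ?thesis
    unfolding G G_shift log_mgf sum_inner_eq_sum_components by (simp add: case_prod_unfold)
qed

definition upper_excess :: "'n \<Rightarrow> real \<Rightarrow> nat \<Rightarrow> 'a \<Rightarrow> real" where
  "upper_excess i \<gamma> t \<omega>
    = exp (2 * (S t \<omega> $ i - vmean (S t \<omega>))) * (walk.exp_excess \<gamma> t \<omega> * walk.below \<gamma> t \<omega>)"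

lemma has_bochner_integral_upper_excess:
  fixes i :: 'n and t :: nat
  defines "row_dev \<equiv> \<lambda>j. deviation (((*v) W ^^ (t + 1 - j)) (axis i 1))"
  shows "has_bochner_integral M (upper_excess i \<gamma> t)
    (exp (2 * \<sigma>\<^sup>2 * (\<Sum>j\<in>{1..t}. (norm (row_dev j))\<^sup>2)) * walk.occupation \<gamma> t)"
proof -
  let ?occ = "\<lambda>\<omega>. walk.exp_excess \<gamma> t \<omega> * walk.below \<gamma> t \<omega>"
  define f where "f x = ennreal (exp ((\<Sum>j\<in>{1..t}. x j) - \<gamma>) * of_bool (stays_below \<gamma> t x))"
    for x :: "nat \<Rightarrow> real"
  define Z where "Z = exp (2 * \<sigma>\<^sup>2 * (\<Sum>j\<in>{1..t}. (norm (row_dev j))\<^sup>2))"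
  have f_meas: "f \<in> borel_measurable (PiM {1..t} (\<lambda>_. borel))"
    unfolding f_def by measurable
  have f_averages: "f (\<lambda>j\<in>{1..t}. vmean (\<eta> j \<omega>)) = ennreal (?occ \<omega>)" for \<omega>
    by (simp add: f_def walk.exp_excess_def walk.below_def
        stays_below_restrict[unfolded One_nat_def])
  have contrast: "vmean (2 *\<^sub>R row_dev j) = 0" for j
    using vmean_deviation[of "((*v) W ^^ (t + 1 - j)) (axis i 1)"]
    by (simp add: row_dev_def vmean_def flip: sum_distrib_left)
  have tilt: "(\<Sum>j\<in>{1..t}. inner (2 *\<^sub>R row_dev j) (\<eta> j \<omega>)) = 2 * (S t \<omega> $ i - vmean (S t \<omega>))" for \<omega>
    unfolding agent_stat_minus_vmean by (simp add: row_dev_def sum_distrib_left)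
  have energy: "\<sigma>\<^sup>2 / 2 * (\<Sum>j\<in>{1..t}. (norm (2 *\<^sub>R row_dev j))\<^sup>2)
      = 2 * \<sigma>\<^sup>2 * (\<Sum>j\<in>{1..t}. (norm (row_dev j))\<^sup>2)"
    by (simp add: power_mult_distrib flip: sum_distrib_left)
  have occ: "integrable M ?occ" "0 \<le> ?occ \<omega>" for \<omega>
    using walk.integrable_exp_excess_power_below[of \<gamma> t 1]
    by (auto simp: walk.exp_excess_nonneg walk.below_def)
  have "(\<integral>\<^sup>+\<omega>. ennreal (upper_excess i \<gamma> t \<omega>) \<partial>M) = ennreal Z * (\<integral>\<^sup>+\<omega>. ennreal (?occ \<omega>) \<partial>M)"
    using nn_integral_exp_contrast[of t "\<lambda>j. 2 *\<^sub>R row_dev j" f, OF contrast f_meas] occ(2)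
    unfolding f_averages tilt energy Z_def[symmetric]
    by (simp only: upper_excess_def ennreal_mult exp_ge_zero)
  then have "(\<integral>\<^sup>+\<omega>. ennreal (upper_excess i \<gamma> t \<omega>) \<partial>M) = ennreal (Z * expectation ?occ)"
    using occ by (simp add: nn_integral_eq_integral ennreal_mult Z_def)
  moreover have "upper_excess i \<gamma> t \<in> borel_measurable M"
    unfolding upper_excess_def[abs_def] by measurable
  ultimately have "has_bochner_integral M (upper_excess i \<gamma> t) (Z * expectation ?occ)"
    using occ(2) by (intro has_bochner_integral_nn_integral) (auto simp: upper_excess_def Z_def)
  then show ?thesis by (simp only: Z_def walk.occupation_def)
qed

lemma
  shows integrable_upper_excess: "integrable M (upper_excess i \<gamma> t)"
    and expectation_upper_excess_le: "expectation (upper_excess i \<gamma> t)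
      \<le> contrast_moment \<sigma> W * walk.occupation \<gamma> t"
proof -
  note integral = has_bochner_integral_upper_excess[of i \<gamma> t]
  show "integrable M (upper_excess i \<gamma> t)" by (rule integrable.intros[OF integral])
  have "2 * \<sigma>\<^sup>2 * (\<Sum>j\<in>{1..t}. (norm (deviation (((*v) W ^^ (t + 1 - j)) (axis i 1))))\<^sup>2)
      \<le> 2 * \<sigma>\<^sup>2 * (1 / (1 - (mixing_rate W)\<^sup>2))"
    by (intro mult_left_mono sum_norm_deviation_rows_le mixing) simp
  then show "expectation (upper_excess i \<gamma> t)
      \<le> contrast_moment \<sigma> W * walk.occupation \<gamma> t"
    unfolding has_bochner_integral_integral_eq[OF integral] contrast_moment_def
    by (intro mult_right_mono walk.occupation_nonneg) simp
qed

definition corridor :: "'n \<Rightarrow> real \<Rightarrow> nat \<Rightarrow> 'a set" where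
  "corridor i \<gamma> t = {\<omega> \<in> space M. \<forall>s\<in>{1..t}. S s \<omega> $ i \<in> {-\<gamma>..\<gamma>} \<and> vmean (S s \<omega>) \<le> \<gamma>}"

lemma corridor_events [measurable]: "corridor i \<gamma> t \<in> events"
  unfolding corridor_def by measurable

lemma corridor_0: "corridor i \<gamma> 0 = space M"
  by (simp add: corridor_def)

lemma corridor_Suc:
  "\<omega> \<in> corridor i \<gamma> (Suc t) \<longleftrightarrow>
    \<omega> \<in> corridor i \<gamma> t \<and> S (Suc t) \<omega> $ i \<in> {-\<gamma>..\<gamma>} \<and> vmean (S (Suc t) \<omega>) \<le> \<gamma>"
  by (auto simp: corridor_def le_Suc_eq simp del: agent_stat.simps)

lemma corridor_stays_below:
  assumes "\<gamma> \<ge> 0" "\<omega> \<in> corridor i \<gamma> t" "vmean (S (Suc t) \<omega>) \<le> \<gamma>"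
  shows "stays_below \<gamma> (Suc t) (\<lambda>j. vmean (\<eta> j \<omega>))"
  unfolding stays_below_def vmean_agent_stat[symmetric]
proof (intro allI impI)
  fix k assume "k \<le> Suc t"
  then consider "k = 0" | "k \<in> {1..t}" | "k = Suc t" by force
  then show "vmean (S k \<omega>) \<le> \<gamma>"
    using assms by cases (auto simp: corridor_def vmean_def[of 0] simp del: agent_stat.simps(2))
qed

lemma integrable_vmean_S: "integrable M (\<lambda>\<omega>. vmean (S t \<omega>))"
  unfolding vmean_agent_stat
  using has_bochner_integral_vmean_eta
  by (intro Bochner_Integration.integrable_sum) (auto simp: has_bochner_integral_iff)

definition corridor_gap :: "'n \<Rightarrow> real \<Rightarrow> nat \<Rightarrow> real" where
  "corridor_gap i \<gamma> t = expectation (\<lambda>\<omega>. (\<gamma> - vmean (S t \<omega>)) * indicator (corridor i \<gamma> t) \<omega>)"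

lemma corridor_gap_0: "corridor_gap i \<gamma> 0 = \<gamma>"
  by (simp add: corridor_gap_def corridor_0 vmean_def prob_space)

lemma has_bochner_integral_corridor_vmean_eta:
  "has_bochner_integral M (\<lambda>\<omega>. indicator (corridor i \<gamma> t) \<omega> * vmean (\<eta> (Suc t) \<omega>))
    (prob (corridor i \<gamma> t) * \<nu>)"
proof -
  define path where "path s x = agent_stat W (\<lambda>j x. x j) s x" for s and x :: "nat \<Rightarrow> real^'n"
  define F :: "(nat \<Rightarrow> real^'n) \<Rightarrow> real"
    where "F x = of_bool (\<forall>s\<in>{1..t}. path s x $ i \<in> {-\<gamma>..\<gamma>} \<and> vmean (path s x) \<le> \<gamma>)" for x
  have path: "path s (\<lambda>j\<in>{1..t}. \<eta> j \<omega>) = S s \<omega>" if "s \<in> {1..t}" for s \<omega>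
    unfolding path_def by (rule agent_stat_cong) (use that in auto)
  have F: "F (\<lambda>j\<in>{1..t}. \<eta> j \<omega>) = indicator (corridor i \<gamma> t) \<omega>" if "\<omega> \<in> space M" for \<omega>
    using that path by (auto simp: F_def corridor_def indicator_def)
  have path_meas: "path s \<in> borel_measurable (PiM {1..t} (\<lambda>_. borel))" if "s \<in> {1..t}" for s
    unfolding path_def by (rule measurable_agent_stat) (use that in auto)
  have [measurable]: "(\<lambda>x. path s x $ i) \<in> borel_measurable (PiM {1..t} (\<lambda>_. borel))"
    "(\<lambda>x. vmean (path s x)) \<in> borel_measurable (PiM {1..t} (\<lambda>_. borel))" if "s \<in> {1..t}" for s
    using measurable_compose[OF path_meas[OF that] borel_measurable_nth]
      measurable_compose[OF path_meas[OF that] borel_measurable_vmean] by auto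
  have "F \<in> borel_measurable (PiM {1..t} (\<lambda>_. borel))"
    unfolding F_def by measurable
  moreover have "integrable M (\<lambda>\<omega>. F (\<lambda>j\<in>{1..t}. \<eta> j \<omega>))"
    by (subst Bochner_Integration.integrable_cong[OF refl F])
      (auto intro: integrable_const_bound[where B=1] simp: indicator_def)
  moreover have "integrable M (\<lambda>\<omega>. vmean (\<eta> (Suc t) \<omega>))" "expectation (\<lambda>\<omega>. vmean (\<eta> (Suc t) \<omega>)) = \<nu>"
    using has_bochner_integral_vmean_eta[of "Suc t"] by (auto simp: has_bochner_integral_iff)
  ultimately have "has_bochner_integral M (\<lambda>\<omega>. F (\<lambda>j\<in>{1..t}. \<eta> j \<omega>) * vmean (\<eta> (Suc t) \<omega>))
      (expectation (\<lambda>\<omega>. F (\<lambda>j\<in>{1..t}. \<eta> j \<omega>)) * \<nu>)"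
    using has_bochner_integral_past_mult_next[OF indep_eta, of F t vmean] by simp
  moreover have "expectation (\<lambda>\<omega>. F (\<lambda>j\<in>{1..t}. \<eta> j \<omega>)) = prob (corridor i \<gamma> t)"
    by (subst Bochner_Integration.integral_cong[OF refl F]) simp_all
  ultimately have "has_bochner_integral M (\<lambda>\<omega>. F (\<lambda>j\<in>{1..t}. \<eta> j \<omega>) * vmean (\<eta> (Suc t) \<omega>))
      (prob (corridor i \<gamma> t) * \<nu>)" by simp
  then show ?thesis
    by (rule has_bochner_integral_cong[THEN iffD1, rotated 3]) (simp_all only: F)
qed

lemma corridor_gap_exit_le:
  assumes \<gamma>: "\<gamma> \<ge> 0"
  shows "(\<gamma> - vmean (S (Suc t) \<omega>)) * indicator (corridor i \<gamma> t) \<omega>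
    \<le> (\<gamma> - vmean (S (Suc t) \<omega>)) * indicator (corridor i \<gamma> (Suc t)) \<omega>
      + upper_excess i \<gamma> (Suc t) \<omega> + \<nu> / q * lower_excess i (Suc t) \<omega>"
proof -
  define x where "x = S (Suc t) \<omega> $ i"
  define s where "s = vmean (S (Suc t) \<omega>)"
  have upper_nonneg: "0 \<le> upper_excess i \<gamma> (Suc t) \<omega>"
    unfolding upper_excess_def
    by (intro mult_nonneg_nonneg walk.exp_excess_nonneg) (simp_all add: walk.below_def)
  have lower_nonneg: "0 \<le> \<nu> / q * lower_excess i (Suc t) \<omega>"
    using decay_rate_pos mean_pos by (simp add: lower_excess_def)
  show ?thesis
  proof (cases "\<omega> \<in> corridor i \<gamma> t \<and> \<omega> \<notin> corridor i \<gamma> (Suc t)")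
    case exit: True
    have "\<gamma> - s \<le> upper_excess i \<gamma> (Suc t) \<omega> + \<nu> / q * lower_excess i (Suc t) \<omega>"
    proof (cases "s \<le> \<gamma>")
      case True
      then have "stays_below \<gamma> (Suc t) (\<lambda>j. vmean (\<eta> j \<omega>))"
        using corridor_stays_below[OF \<gamma>, of \<omega> i t] exit by (simp only: s_def)
      then have "upper_excess i \<gamma> (Suc t) \<omega> = exp (2 * (x - s)) * exp (s - \<gamma>)"
        unfolding upper_excess_def walk.exp_excess_def walk.below_def x_def s_def vmean_agent_stat
        by simp
      moreover have "x \<notin> {-\<gamma>..\<gamma>}"
        using exit True unfolding corridor_Suc x_def s_def by blast
      then have "\<gamma> - s \<le> exp (2 * (x - s)) * exp (s - \<gamma>) + exp (- (q / \<nu>) * (x + s)) / (q / \<nu>)"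
        using True decay_rate_pos mean_pos by (intro overshoot_le) simp_all
      moreover have "exp (- (q / \<nu>) * (x + s)) / (q / \<nu>) = \<nu> / q * lower_excess i (Suc t) \<omega>"
        by (simp only: lower_excess_def x_def s_def divide_divide_eq_right
            times_divide_eq_left mult.commute)
      ultimately show ?thesis by linarith
    next
      case False
      then show ?thesis using upper_nonneg lower_nonneg by linarith
    qed
    then show ?thesis using exit by (simp add: s_def del: agent_stat.simps)
  next
    case False
    then have same: "indicator (corridor i \<gamma> t) \<omega> = (indicator (corridor i \<gamma> (Suc t)) \<omega> :: real)"
      unfolding indicator_def corridor_Suc by auto
    show ?thesis unfolding same using upper_nonneg lower_nonneg by linarith
  qed
qed

lemma integrable_gap_mult_indicator_corridor:
  "integrable M (\<lambda>\<omega>. (\<gamma> - vmean (S s \<omega>)) * indicator (corridor i \<gamma> t) \<omega>)"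
  using corridor_events by (rule integrable_real_mult_indicator) (simp add: integrable_vmean_S)

lemma corridor_gap_step:
  assumes \<gamma>: "\<gamma> \<ge> 0"
  shows "corridor_gap i \<gamma> t - \<nu> * prob (corridor i \<gamma> t)
    \<le> corridor_gap i \<gamma> (Suc t)
      + contrast_moment \<sigma> W * walk.occupation \<gamma> (Suc t) + \<nu> / q * exp (- q) ^ Suc t"
proof -
  let ?gap = "\<lambda>\<omega>. \<gamma> - vmean (S (Suc t) \<omega>)"
  note integrable = integrable_gap_mult_indicator_corridor[of \<gamma> "Suc t" i]
    integrable_upper_excess[of i \<gamma> "Suc t"] integrable_lower_excess[of i "Suc t"]
  have "has_bochner_integral M (\<lambda>\<omega>. (\<gamma> - vmean (S t \<omega>)) * indicator (corridor i \<gamma> t) \<omega>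
      - indicator (corridor i \<gamma> t) \<omega> * vmean (\<eta> (Suc t) \<omega>))
      (corridor_gap i \<gamma> t - prob (corridor i \<gamma> t) * \<nu>)"
    unfolding corridor_gap_def
    by (intro has_bochner_integral_diff has_bochner_integral_corridor_vmean_eta
        has_bochner_integral_integrable integrable_gap_mult_indicator_corridor)
  moreover have "?gap \<omega> * indicator (corridor i \<gamma> t) \<omega>
      = (\<gamma> - vmean (S t \<omega>)) * indicator (corridor i \<gamma> t) \<omega>
        - indicator (corridor i \<gamma> t) \<omega> * vmean (\<eta> (Suc t) \<omega>)" for \<omega>
    by (simp add: vmean_mult vmean_add algebra_simps)
  ultimately have "corridor_gap i \<gamma> t - \<nu> * prob (corridor i \<gamma> t)
      = expectation (\<lambda>\<omega>. ?gap \<omega> * indicator (corridor i \<gamma> t) \<omega>)"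
    by (simp only: has_bochner_integral_integral_eq mult.commute)
  also have "\<dots> \<le> expectation (\<lambda>\<omega>. ?gap \<omega> * indicator (corridor i \<gamma> (Suc t)) \<omega>
      + upper_excess i \<gamma> (Suc t) \<omega> + \<nu> / q * lower_excess i (Suc t) \<omega>)"
    using integrable corridor_gap_exit_le[OF \<gamma>]
    by (intro integral_mono Bochner_Integration.integrable_add integrable_mult_right
        integrable_gap_mult_indicator_corridor)
  also have "\<dots> = corridor_gap i \<gamma> (Suc t) + expectation (upper_excess i \<gamma> (Suc t))
      + \<nu> / q * expectation (lower_excess i (Suc t))"
    using integrable by (simp add: corridor_gap_def del: agent_stat.simps)
  also have "\<dots> \<le> corridor_gap i \<gamma> (Suc t)
      + contrast_moment \<sigma> W * walk.occupation \<gamma> (Suc t) + \<nu> / q * exp (- q) ^ Suc t"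
    using decay_rate_pos mean_pos
    by (intro add_mono order_refl mult_left_mono expectation_upper_excess_le
        expectation_lower_excess_le) auto
  finally show ?thesis .
qed

lemma corridor_gap_le:
  assumes \<gamma>: "\<gamma> \<ge> 0"
  shows "corridor_gap i \<gamma> t \<le> \<nu> / q * exp (q / \<nu> * (2 * \<gamma>)) * exp (- q) ^ t"
proof -
  have \<theta>: "q / \<nu> > 0" using decay_rate_pos mean_pos by simp
  have "(\<gamma> - vmean (S t \<omega>)) * indicator (corridor i \<gamma> t) \<omega>
      \<le> \<nu> / q * exp (q / \<nu> * (2 * \<gamma>)) * lower_excess i t \<omega>" for \<omega>
  proof (cases "\<omega> \<in> corridor i \<gamma> t")
    case True
    have "S t \<omega> $ i \<le> \<gamma>"
      using True \<gamma> by (cases "t = 0") (auto simp: corridor_def)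
    then have "q / \<nu> * (\<gamma> - vmean (S t \<omega>)) \<le> q / \<nu> * (2 * \<gamma> - (S t \<omega> $ i + vmean (S t \<omega>)))"
      using \<theta> by (intro mult_left_mono) auto
    also have "\<dots> \<le> exp (q / \<nu> * (2 * \<gamma> - (S t \<omega> $ i + vmean (S t \<omega>))))"
      by (rule order_trans[OF _ exp_ge_add_one_self]) simp
    also have "\<dots> = exp (q / \<nu> * (2 * \<gamma>)) * lower_excess i t \<omega>"
      unfolding lower_excess_def exp_add[symmetric] by (simp add: algebra_simps)
    finally show ?thesis
      using True decay_rate_pos mean_pos by (simp add: field_simps)
  next
    case False
    then show ?thesis
      using decay_rate_pos mean_pos by (simp add: lower_excess_def)
  qed
  then have "corridor_gap i \<gamma> t
      \<le> expectation (\<lambda>\<omega>. \<nu> / q * exp (q / \<nu> * (2 * \<gamma>)) * lower_excess i t \<omega>)"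
    unfolding corridor_gap_def
    by (intro integral_mono integrable_gap_mult_indicator_corridor integrable_mult_right
        integrable_lower_excess)
  also have "\<dots> = \<nu> / q * exp (q / \<nu> * (2 * \<gamma>)) * expectation (lower_excess i t)"
    by simp
  also have "\<dots> \<le> \<nu> / q * exp (q / \<nu> * (2 * \<gamma>)) * exp (- q) ^ t"
    using decay_rate_pos mean_pos by (intro mult_left_mono expectation_lower_excess_le) auto
  finally show ?thesis .
qed

lemma corridor_subset_no_exit: "corridor i \<gamma> t \<subseteq> no_exit M S i (- \<gamma>) \<gamma> t"
  by (auto simp: corridor_def no_exit_def)

lemma corridor_gap_telescope:
  assumes \<gamma>: "\<gamma> \<ge> 0"
  shows "\<gamma> - \<nu> * (\<Sum>t<n. prob (corridor i \<gamma> t)) \<le> corridor_gap i \<gamma> n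
    + contrast_moment \<sigma> W * (\<Sum>t<n. walk.occupation \<gamma> (Suc t))
    + \<nu> / q * (\<Sum>t<n. exp (- q) ^ Suc t)"
proof (induction n)
  case 0
  show ?case by (simp add: corridor_gap_0)
next
  case (Suc n)
  then show ?case
    using corridor_gap_step[OF \<gamma>, of i n] by (simp add: algebra_simps del: power_Suc)
qed

lemma sum_prob_corridor_ge:
  assumes \<gamma>: "\<gamma> \<ge> 0"
  shows "\<gamma> - exit_deficit \<nu> \<sigma> W - \<nu> / q * exp (q / \<nu> * (2 * \<gamma>)) * exp (- q) ^ n
    \<le> \<nu> * (\<Sum>t<n. prob (corridor i \<gamma> t))"
proof -
  have "(\<Sum>t<n. walk.occupation \<gamma> (Suc t)) \<le> (\<Sum>t<Suc n. walk.occupation \<gamma> t)"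
    unfolding sum.lessThan_Suc_shift by (simp add: walk.occupation_nonneg)
  also have "\<dots> \<le> exp (2 * \<nu> + 2 * \<sigma>\<^sup>2 / real CARD('n)) / \<nu>\<^sup>2"
    by (rule walk.sum_occupation_le[OF \<gamma>])
  finally have occ: "(\<Sum>t<n. walk.occupation \<gamma> (Suc t))
      \<le> exp (2 * \<nu> + 2 * \<sigma>\<^sup>2 / real CARD('n)) / \<nu>\<^sup>2" .
  have "(\<Sum>t<n. exp (- q) ^ Suc t) \<le> (\<Sum>t<Suc n. exp (- q) ^ t)"
    unfolding sum.lessThan_Suc_shift by simp
  also have "\<dots> \<le> (\<Sum>t. exp (- q) ^ t)"
    using decay_rate_pos by (intro sum_le_suminf summable_geometric) auto
  also have "\<dots> = 1 / (1 - exp (- q))"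
    using decay_rate_pos by (intro suminf_geometric) simp
  finally have geom: "(\<Sum>t<n. exp (- q) ^ Suc t) \<le> 1 / (1 - exp (- q))" .
  have "contrast_moment \<sigma> W * (\<Sum>t<n. walk.occupation \<gamma> (Suc t))
      + \<nu> / q * (\<Sum>t<n. exp (- q) ^ Suc t) \<le> exit_deficit \<nu> \<sigma> W"
    unfolding exit_deficit_def using decay_rate_pos mean_pos
    by (intro add_mono mult_left_mono occ geom) (auto simp: contrast_moment_def)
  then show ?thesis
    using corridor_gap_telescope[OF \<gamma>, where n=n and i=i] corridor_gap_le[OF \<gamma>, where t=n and i=i]
    by linarith
qed

lemma suminf_prob_no_exit_ge:
  assumes \<gamma>: "\<gamma> \<ge> 0" and summable: "summable (\<lambda>t. prob (no_exit M S i (- \<gamma>) \<gamma> t))"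
  shows "\<gamma> - exit_deficit \<nu> \<sigma> W \<le> \<nu> * (\<Sum>t. prob (no_exit M S i (- \<gamma>) \<gamma> t))"
proof (rule LIMSEQ_le_const2)
  let ?C = "\<nu> / q * exp (q / \<nu> * (2 * \<gamma>))"
  have "(\<lambda>n. \<gamma> - exit_deficit \<nu> \<sigma> W - ?C * exp (- q) ^ n) \<longlonglongrightarrow> \<gamma> - exit_deficit \<nu> \<sigma> W - ?C * 0"
    using decay_rate_pos by (intro tendsto_intros LIMSEQ_power_zero) simp
  then show "(\<lambda>n. \<gamma> - exit_deficit \<nu> \<sigma> W - ?C * exp (- q) ^ n) \<longlonglongrightarrow> \<gamma> - exit_deficit \<nu> \<sigma> W"
    by simp
  have "\<gamma> - exit_deficit \<nu> \<sigma> W - ?C * exp (- q) ^ n \<le> \<nu> * (\<Sum>t. prob (no_exit M S i (- \<gamma>) \<gamma> t))"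
    for n
  proof -
    have "(\<Sum>t<n. prob (corridor i \<gamma> t)) \<le> (\<Sum>t<n. prob (no_exit M S i (- \<gamma>) \<gamma> t))"
    proof (intro sum_mono finite_measure_mono corridor_subset_no_exit)
      show "no_exit M S i (- \<gamma>) \<gamma> t \<in> events" for t unfolding no_exit_def by measurable
    qed
    also have "\<dots> \<le> (\<Sum>t. prob (no_exit M S i (- \<gamma>) \<gamma> t))"
      by (rule sum_le_suminf[OF summable]) auto
    finally have "\<nu> * (\<Sum>t<n. prob (corridor i \<gamma> t)) \<le> \<nu> * (\<Sum>t. prob (no_exit M S i (- \<gamma>) \<gamma> t))"
      using mean_pos by (intro mult_left_mono) auto
    then show ?thesis using sum_prob_corridor_ge[OF \<gamma>, where n=n and i=i] by linarith
  qed
  then show "\<exists>k. \<forall>n\<ge>k. \<gamma> - exit_deficit \<nu> \<sigma> W - ?C * exp (- q) ^ n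
      \<le> \<nu> * (\<Sum>t. prob (no_exit M S i (- \<gamma>) \<gamma> t))"
    by blast
qed

lemma expected_exit_time_bounds:
  assumes \<gamma>: "2/7 * ln 4 \<le> q * (\<gamma> / \<nu>)"
  shows "ereal ((\<gamma> - exit_deficit \<nu> \<sigma> W) / \<nu>) \<le> expected_time M (exit_time S i (- \<gamma>) \<gamma>)"
    and "expected_time M (exit_time S i (- \<gamma>) \<gamma>) \<le> ereal (5/4 * (\<gamma> / \<nu>) + 1 / (1 - exp (- q)))"
proof -
  have "\<gamma> \<ge> 0" using threshold_pos[OF \<gamma>] by simp
  note summable = summable_prob_no_exit[OF \<gamma>, of i "- \<gamma>"]
  note expected = expected_time_exit_time[OF measurable_S_nth summable]
  show "ereal ((\<gamma> - exit_deficit \<nu> \<sigma> W) / \<nu>) \<le> expected_time M (exit_time S i (- \<gamma>) \<gamma>)"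
    using suminf_prob_no_exit_ge[OF \<open>\<gamma> \<ge> 0\<close> summable] mean_pos
    by (simp add: expected pos_divide_le_eq mult.commute)
  show "expected_time M (exit_time S i (- \<gamma>) \<gamma>) \<le> ereal (5/4 * (\<gamma> / \<nu>) + 1 / (1 - exp (- q)))"
    using suminf_prob_no_exit_le[OF \<gamma>, of i "- \<gamma>"] by (simp add: expected)
qed

lemma expected_exit_time_log_thresholds:
  assumes \<epsilon>: "0 < \<epsilon>" "\<epsilon> < 1/2"
    and high: "h = 2/7 * (\<nu> / q) * (ln (2 / \<epsilon>) - ln (1 - exp (- q)))"
    and low: "l = 2/7 * (\<nu> / q) * (ln (\<epsilon> / 2) + ln (1 - exp (- q)))"
  shows "ereal ((1 - 2 * \<epsilon>) * h / \<nu> - exit_deficit \<nu> \<sigma> W / \<nu>) \<le> expected_time M (exit_time S i l h)"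
    and "expected_time M (exit_time S i l h) \<le> ereal (5 * h / (4 * \<nu>) + 1 / (1 - exp (- q)))"
proof -
  have "ln (\<epsilon> / 2) + ln (1 - exp (- q)) = - (ln (2 / \<epsilon>) - ln (1 - exp (- q)))"
    using \<epsilon> by (simp add: ln_div)
  then have symmetric: "l = - h" unfolding low high by (simp only: mult_minus_right)
  have "ln 4 \<le> ln (2 / \<epsilon>)" using \<epsilon> by (subst ln_le_cancel_iff) (auto simp: field_simps)
  moreover have "ln (1 - exp (- q)) \<le> 0" using decay_rate_pos by simp
  moreover have "q * (h / \<nu>) = 2/7 * (ln (2 / \<epsilon>) - ln (1 - exp (- q)))"
    using decay_rate_pos mean_pos by (simp add: high)
  ultimately have h: "2/7 * ln 4 \<le> q * (h / \<nu>)" by simp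
  have "(1 - 2 * \<epsilon>) * h \<le> h" using \<epsilon> threshold_pos[OF h] by simp
  then have "(1 - 2 * \<epsilon>) * h / \<nu> - exit_deficit \<nu> \<sigma> W / \<nu> \<le> (h - exit_deficit \<nu> \<sigma> W) / \<nu>"
    using mean_pos by (simp add: divide_right_mono diff_divide_distrib)
  then show "ereal ((1 - 2 * \<epsilon>) * h / \<nu> - exit_deficit \<nu> \<sigma> W / \<nu>)
      \<le> expected_time M (exit_time S i l h)"
    unfolding symmetric by (intro order_trans[OF _ expected_exit_time_bounds(1)[OF h]]) simp
  show "expected_time M (exit_time S i l h) \<le> ereal (5 * h / (4 * \<nu>) + 1 / (1 - exp (- q)))"
    unfolding symmetric using expected_exit_time_bounds(2)[OF h] by simp
qed

end

section \<open>The expected exit time\<close>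

lemma gaussian_consensus_of_model:
  fixes W :: "real^'n::finite^'n"
  assumes \<mu>: "\<mu> \<noteq> 0" and \<sigma>: "\<sigma> > 0" and W: "weight_matrix E W" "mixing_rate W < 1"
    and m: "m = 2 * \<mu>\<^sup>2 / \<sigma>\<^sup>2"
    and model: "gaussian_shift_model \<mu> \<sigma> P (y :: 'n \<Rightarrow> nat \<Rightarrow> 'a \<Rightarrow> real)"
  shows "gaussian_consensus (P H1) W (llr \<mu> \<sigma> y) m (sqrt (2 * m))"
proof -
  interpret prob_space "P H1" using model by (simp add: gaussian_shift_model_def)
  have indep: "indep_vars (\<lambda>_. borel) (\<lambda>(i, t) \<omega>. y i t \<omega> - \<mu>) (UNIV \<times> {1..})"
    and noise: "\<And>i t. t \<ge> 1 \<Longrightarrow> distributed (P H1) lborel (\<lambda>\<omega>. y i t \<omega> - \<mu>) (normal_density 0 \<sigma>)"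
    using model unfolding gaussian_shift_model_def by (metis signal_mean.simps(2))+
  define c where "c = 2 * \<mu> / \<sigma>\<^sup>2"
  have c: "c \<noteq> 0" using \<mu> \<sigma> by (simp add: c_def)
  have llr: "llr \<mu> \<sigma> y t \<omega> $ i = m + c * (y i t \<omega> - \<mu>)" for t \<omega> i
    using \<sigma> by (simp add: llr_def m c_def field_simps power2_eq_square)
  have "\<bar>c\<bar> * \<sigma> = sqrt ((\<bar>c\<bar> * \<sigma>)\<^sup>2)" using \<sigma> by simp
  also have "(\<bar>c\<bar> * \<sigma>)\<^sup>2 = 2 * m" using \<sigma> by (simp add: c_def m power2_eq_square)
  finally have sd: "\<bar>c\<bar> * \<sigma> = sqrt (2 * m)" .
  show ?thesis
  proof
    show "m > 0" "sqrt (2 * m) > 0" using \<mu> \<sigma> by (simp_all add: m)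
    have "indep_vars (\<lambda>_. borel) (\<lambda>p \<omega>. m + c * (case p of (i, t) \<Rightarrow> (\<lambda>\<omega>. y i t \<omega> - \<mu>)) \<omega>)
        (UNIV \<times> {1..})"
      by (rule indep_vars_compose2[OF indep]) auto
    then show "indep_vars (\<lambda>_. borel) (\<lambda>(i, t) \<omega>. llr \<mu> \<sigma> y t \<omega> $ i) (UNIV \<times> {1..})"
      unfolding llr by (simp add: case_prod_unfold)
    show "distributed (P H1) lborel (\<lambda>\<omega>. llr \<mu> \<sigma> y t \<omega> $ i) (normal_density m (sqrt (2 * m)))"
      if "t \<ge> 1" for t i
      using normal_density_affine[OF noise[OF that] \<sigma> c, of m] unfolding llr sd by simp
  qed (use W in \<open>auto simp: weight_matrix_def\<close>)
qed

lemma decay_rate_llr: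
  fixes W :: "real^'n::finite^'n"
  assumes "m > 0"
  shows "decay_rate m (sqrt (2 * m)) W
    = real CARD('n) * m / (4 * (real CARD('n) * (mixing_rate W)\<^sup>2 + 1))"
proof -
  have "row_energy W = (real CARD('n) * (mixing_rate W)\<^sup>2 + 1) / real CARD('n)"
    by (simp add: row_energy_def field_simps)
  then show ?thesis using assms by (simp add: decay_rate_def power2_eq_square[of m])
qed

lemma exit_deficit_pos:
  assumes "mixing_rate W < 1" "\<nu> > 0" "\<sigma> > 0"
  shows "0 < exit_deficit \<nu> \<sigma> W"
proof -
  have "0 < decay_rate \<nu> \<sigma> W"
    using assms row_energy_pos[of W] by (simp add: decay_rate_def)
  then show ?thesis
    unfolding exit_deficit_def contrast_moment_def using assms
    by (intro add_pos_pos mult_pos_pos divide_pos_pos) auto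
qed

theorem theorem4p7:
  fixes \<mu> \<sigma> m r k N :: real
    and E :: "('n::finite \<times> 'n) set"
    and W :: "real^'n^'n"
  assumes "\<mu> \<noteq> 0" and "\<sigma> > 0"
    and "connected_simple_graph E"
    and "weight_matrix E W"
    and "N = real CARD('n)"
    and "m = 2 * \<mu>\<^sup>2 / \<sigma>\<^sup>2"
    and "r = onorm (\<lambda>x. (W - averaging_matrix) *v x)"
    and "r < 1"
    and "k = N * r\<^sup>2"
  shows "\<exists>c>0. \<forall>(P :: hyp \<Rightarrow> 'a measure) (y :: 'n \<Rightarrow> nat \<Rightarrow> 'a \<Rightarrow> real).
    gaussian_shift_model \<mu> \<sigma> P y \<longrightarrow>
    (\<forall>\<epsilon> (\<gamma>h :: 'n \<Rightarrow> real) (\<gamma>l :: 'n \<Rightarrow> real).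
       0 < \<epsilon> \<and> \<epsilon> < 1/2 \<and>
       (\<forall>i. \<gamma>h i = 8 * (k + 1) / (7 * N) *
                (ln (2 / \<epsilon>) - ln (1 - exp (- (N * m / (4 * (k + 1))))))) \<and>
       (\<forall>i. \<gamma>l i = 8 * (k + 1) / (7 * N) *
                (ln (\<epsilon> / 2) + ln (1 - exp (- (N * m / (4 * (k + 1))))))) \<longrightarrow>
       (\<forall>i. let ET = expected_time (P H1)
                       (exit_time (agent_stat W (llr \<mu> \<sigma> y)) i (\<gamma>l i) (\<gamma>h i))
            in ereal ((1 - 2 * \<epsilon>) * \<gamma>h i / m - c / m) \<le> ET \<and>
               ET \<le> ereal (5 * \<gamma>h i / (4 * m) + 1 / (1 - exp (- (N * m / (4 * (k + 1))))))))"
proof -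
  define q where "q = N * m / (4 * (k + 1))"
  define c where "c = exit_deficit m (sqrt (2 * m)) W"
  have r: "mixing_rate W = r" using assms(7) by (simp add: mixing_rate_def)
  have m: "m > 0" using assms(1,2,6) by simp
  have q: "q = decay_rate m (sqrt (2 * m)) W"
    using decay_rate_llr[OF m, of W] assms(5,9) by (simp add: q_def r)
  have factor: "8 * (k + 1) / (7 * N) = 2/7 * (m / q)"
    using m assms(5,9) by (simp add: q_def)
  show ?thesis
    unfolding q_def[symmetric] factor
  proof (intro exI[of _ c] conjI allI impI)
    show "c > 0" unfolding c_def using m assms(8) by (intro exit_deficit_pos) (simp_all add: r)
  next
    fix P :: "hyp \<Rightarrow> 'a measure" and y :: "'n \<Rightarrow> nat \<Rightarrow> 'a \<Rightarrow> real"
      and \<epsilon> :: real and \<gamma>h \<gamma>l :: "'n \<Rightarrow> real" and i :: 'n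
    assume "gaussian_shift_model \<mu> \<sigma> P y"
    then interpret gaussian_consensus "P H1" W "llr \<mu> \<sigma> y" m "sqrt (2 * m)"
      using assms by (intro gaussian_consensus_of_model) (auto simp: r)
    assume "0 < \<epsilon> \<and> \<epsilon> < 1/2 \<and>
      (\<forall>i. \<gamma>h i = 2/7 * (m / q) * (ln (2 / \<epsilon>) - ln (1 - exp (- q)))) \<and>
      (\<forall>i. \<gamma>l i = 2/7 * (m / q) * (ln (\<epsilon> / 2) + ln (1 - exp (- q))))"
    then show "let ET = expected_time (P H1) (exit_time S i (\<gamma>l i) (\<gamma>h i))
        in ereal ((1 - 2 * \<epsilon>) * \<gamma>h i / m - c / m) \<le> ET \<and>
           ET \<le> ereal (5 * \<gamma>h i / (4 * m) + 1 / (1 - exp (- q)))"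
      unfolding q c_def Let_def by (intro conjI expected_exit_time_log_thresholds) auto
  qed
qed

end
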